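(* The sequence $\{x^{(t)}:t\in\mathbb{N}\}$ generated by CMPGA_ML applied to the $L_1/S_K$ sparse signal recovery problem $$\min\left\{\frac{\|x\|_1+\frac{\lambda}{2}\|Ax-b\|_2^2}{\|x\|_{(K)}}:\ \underline{x}\le x\le\overline{x},\ x\ne0,\ x\in\mathbb{R}^n\right\}$$ converges R-linearly to a critical point of $F$.
   Context: Data. $A\in\mathbb{R}^{m\times n}$, $b\in\mathbb{R}^m\setminus\{0\}$, $\underline{x},\overline{x}\in\mathbb{R}^n$, $\lambda>0$, $K\in\{1,\dots,n\}$. $\|x\|_{(K)}$ is the vector $K$-norm: the sum of the $K$ largest absolute values of entries of $x$. The components of $x\in\mathbb{R}^n$ are partitioned into subvectors $x_1,\dots,x_N$ with $x_i\in\mathbb{R}^{n_i}$. Put $f_i(x_i)=\|x_i\|_1$ if $\underline{x}_i\le x_i\le\overline{x}_i$ (componentwise) and $f_i(x_i)=+\infty$ otherwise; $f(x)=\sum_{i=1}^Nf_i(x_i)$; $h(x)=\frac{\lambda}{2}\|Ax-b\|_2^2$; $g(x)=\|x\|_{(K)}$; $\Omega=\{x:g(x)\ne0\}=\mathbb{R}^n\setminus\{0\}$. Notation. $\mathrm{dom}(\varphi)=\{x:\varphi(x)<+\infty\}$; $g^*(y)=\sup_x\{\langle x,y\rangle-g(x)\}$; $\partial g$ is the convex subdifferential; $\nabla_ih$ is the partial gradient with respect to $x_i$; $\zeta:=f+h$; $\eta(x,y):=\langle x,y\rangle-g^*(y)$. $F(x)=\zeta(x)/g(x)$ if $x\in\Omega\cap\mathrm{dom}(f)$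 and $F(x)=+\infty$ otherwise. $Q(x,y)=\zeta(x)/\eta(x,y)$ if $(x,y)\in\mathrm{dom}(f)\times\mathrm{dom}(g^* )$ and $\eta(x,y)>0$, and $Q(x,y)=+\infty$ otherwise. $\mathrm{prox}_{\varphi}(x)=\arg\min_z\{\varphi(z)+\frac12\|z-x\|_2^2\}$. The Fréchet subdifferential is $\widehat{\partial}\varphi(x)=\{y:\liminf_{z\to x,z\ne x}\frac{\varphi(z)-\varphi(x)-\langle y,z-x\rangle}{\|z-x\|_2}\ge0\}$. $x^{\star}\in\mathrm{dom}(F)$ is a critical point of $F$ if $0\in\widehat{\partial}f(x^{\star})+\nabla h(x^{\star})-F(x^{\star})\,\partial g(x^{\star})$. Algorithm CMPGA_ML (cyclic multi-proximity gradient algorithm with monotone line search). Input: $x^{(0)}\in\mathrm{dom}(F)$, $y^{(0)}\in\partial g(x^{(0)})$, reals $0<\underline{\alpha}\le\overline{\alpha}$, $\sigma>0$, $0<\gamma<1$. For $t=0,1,2,\dots$: let $Q_{(t)}=Q(x^{(t)},y^{(t)})$, $i=t\bmod(N+1)$, and choose an initial $\alpha\in[\underline{\alpha},\overline{\alpha}]$. If $i=0$: set $x^{(t+1)}=x^{(t)}$, $y^{(t+1)}=\mathrm{prox}_{\alpha g^*}(y^{(t)}+\alpha x^{(t)})$. If $i\ge1$: ( * ) compute $x_i^{(t)}(\alpha)\in\mathrm{prox}_{\alpha f_i}\big(x_i^{(t)}-\alpha\nabla_ih(x^{(t)})+\alpha Q_{(t)}y_i^{(t)}\big)$ and let $x^{(t),i}(\alpha)$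 be $x^{(t)}$ with its $i$-th block replaced by $x_i^{(t)}(\alpha)$. If $\zeta(x^{(t),i}(\alpha))+\frac{\sigma}{2}\|x^{(t),i}(\alpha)-x^{(t)}\|_2^2\le Q_{(t)}\,\eta(x^{(t),i}(\alpha),y^{(t)})$, set $(x^{(t+1)},y^{(t+1)})=(x^{(t),i}(\alpha),y^{(t)})$; otherwise replace $\alpha$ by $\alpha\gamma$ and repeat ( * ). R-linear convergence of $x^{(t)}$ to $x^{\star}$: there are $T_1>0$, $c_1>0$, $\tau\in(0,1)$ with $\|x^{(t)}-x^{\star}\|_2\le c_1\tau^t$ for all $t\ge T_1$. *)

theory Defs
  imports "HOL-Analysis.Analysis"
begin

definition eff_dom :: "('a \<Rightarrow> ereal) \<Rightarrow> 'a set" where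
  "eff_dom \<phi> = {x. \<phi> x < \<infinity>}"

definition fenchel_conj :: "('a::real_inner \<Rightarrow> real) \<Rightarrow> 'a \<Rightarrow> ereal" where
  "fenchel_conj g y = (SUP x. ereal (x \<bullet> y - g x))"

definition convex_subdiff :: "('a::real_inner \<Rightarrow> real) \<Rightarrow> 'a \<Rightarrow> 'a set" where
  "convex_subdiff g x = {y. \<forall>z. g z \<ge> g x + y \<bullet> (z - x)}"

text \<open>Only meant for points \<open>x\<close> at which \<open>\<phi>\<close> is finite.\<close>

definition frechet_subdiff :: "('a::real_inner \<Rightarrow> ereal) \<Rightarrow> 'a \<Rightarrow> 'a set" where
  "frechet_subdiff \<phi> x =
     {y. Liminf (at x) (\<lambda>z. (\<phi> z - \<phi> x - ereal (y \<bullet> (z - x))) / ereal (norm (z - x))) \<ge> 0}"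

definition gradient :: "('a::real_inner \<Rightarrow> real) \<Rightarrow> 'a \<Rightarrow> 'a" where
  "gradient h x = (THE D. GDERIV h x :> D)"

text \<open>
  The set of minimisers, over the subspace \<open>S\<close>, of the proximal objective.  The whole space is
  \<open>S = UNIV\<close>; a space of subvectors is the subspace \<open>block_space\<close> below.
\<close>

definition prox :: "('a::real_inner) set \<Rightarrow> ('a \<Rightarrow> ereal) \<Rightarrow> 'a \<Rightarrow> 'a set" where
  "prox S \<phi> v =
     {z \<in> S. \<forall>w\<in>S. \<phi> z + ereal (1/2 * (norm (z - v))\<^sup>2) \<le> \<phi> w + ereal (1/2 * (norm (w - v))\<^sup>2)}"

definition R_linearly_converges :: "(nat \<Rightarrow> 'a::real_normed_vector) \<Rightarrow> 'a \<Rightarrow> bool" where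
  "R_linearly_converges x xs \<longleftrightarrow>
     (\<exists>T>0. \<exists>c>0. \<exists>\<tau>\<in>{0<..<1}. \<forall>t\<ge>T. norm (x t - xs) \<le> c * \<tau> ^ t)"

text \<open>
  A partition of the components into subvectors \<open>x\<^sub>1, \<dots>, x\<^sub>N\<close> is a map \<open>blk\<close> sending each index
  to the number of its block.  The space of \<open>i\<close>-th subvectors is represented by
  the isometric copy consisting of the vectors that vanish outside block \<open>i\<close>.
\<close>

definition block_partition :: "('n \<Rightarrow> nat) \<Rightarrow> nat \<Rightarrow> bool" where
  "block_partition blk N \<longleftrightarrow> range blk = {1..N}"

definition block_space :: "('n \<Rightarrow> nat) \<Rightarrow> nat \<Rightarrow> (real^'n) set" where
  "block_space blk i = {z. \<forall>j. blk j \<noteq> i \<longrightarrow> z $ j = 0}"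

definition block :: "('n \<Rightarrow> nat) \<Rightarrow> nat \<Rightarrow> real^'n \<Rightarrow> real^'n" where
  "block blk i x = (\<chi> j. if blk j = i then x $ j else 0)"

definition replace_block :: "('n \<Rightarrow> nat) \<Rightarrow> nat \<Rightarrow> real^'n \<Rightarrow> real^'n \<Rightarrow> real^'n" where
  "replace_block blk i z x = (\<chi> j. if blk j = i then z $ j else x $ j)"

definition block_sum ::
  "('n \<Rightarrow> nat) \<Rightarrow> nat \<Rightarrow> (nat \<Rightarrow> real^'n \<Rightarrow> ereal) \<Rightarrow> real^'n \<Rightarrow> ereal" where
  "block_sum blk N fi x = (\<Sum>i=1..N. fi i (block blk i x))"

definition partial_gradient ::
  "('n::finite \<Rightarrow> nat) \<Rightarrow> nat \<Rightarrow> (real^'n \<Rightarrow> real) \<Rightarrow> real^'n \<Rightarrow> real^'n" where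
  "partial_gradient blk i h x = block blk i (gradient h x)"

definition zeta :: "('a \<Rightarrow> ereal) \<Rightarrow> ('a \<Rightarrow> real) \<Rightarrow> 'a \<Rightarrow> ereal" where
  "zeta f h x = f x + ereal (h x)"

definition eta :: "('a::real_inner \<Rightarrow> real) \<Rightarrow> 'a \<Rightarrow> 'a \<Rightarrow> ereal" where
  "eta g x y = ereal (x \<bullet> y) - fenchel_conj g y"

definition frac_F ::
  "('a \<Rightarrow> ereal) \<Rightarrow> ('a \<Rightarrow> real) \<Rightarrow> ('a \<Rightarrow> real) \<Rightarrow> 'a \<Rightarrow> ereal" where
  "frac_F f h g x =
     (if g x \<noteq> 0 \<and> x \<in> eff_dom f then zeta f h x / ereal (g x) else \<infinity>)"

definition frac_Q ::
  "('a::real_inner \<Rightarrow> ereal) \<Rightarrow> ('a \<Rightarrow> real) \<Rightarrow> ('a \<Rightarrow> real) \<Rightarrow> 'a \<Rightarrow> 'a \<Rightarrow> ereal" where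
  "frac_Q f h g x y =
     (if x \<in> eff_dom f \<and> y \<in> eff_dom (fenchel_conj g) \<and> eta g x y > 0
      then zeta f h x / eta g x y else \<infinity>)"

definition critical_point ::
  "('a::real_inner \<Rightarrow> ereal) \<Rightarrow> ('a \<Rightarrow> real) \<Rightarrow> ('a \<Rightarrow> real) \<Rightarrow> 'a \<Rightarrow> bool" where
  "critical_point f h g x \<longleftrightarrow>
     x \<in> eff_dom (frac_F f h g) \<and>
     0 \<in> {u + gradient h x - real_of_ereal (frac_F f h g x) *\<^sub>R v | u v.
            u \<in> frechet_subdiff f x \<and> v \<in> convex_subdiff g x}"

definition accepts ::
  "('a::real_inner \<Rightarrow> ereal) \<Rightarrow> ('a \<Rightarrow> real) \<Rightarrow> ('a \<Rightarrow> real) \<Rightarrow> real \<Rightarrow> 'a \<Rightarrow> 'a \<Rightarrow> 'a \<Rightarrow> bool" where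
  "accepts f h g \<sigma> x y z \<longleftrightarrow>
     zeta f h z + ereal (\<sigma> / 2 * (norm (z - x))\<^sup>2) \<le> frac_Q f h g x y * eta g z y"

text \<open>
  The quotient \<open>frac_Q\<close> acts here as a real scalar; it is finite and positive along every run
  of the algorithm below when \<open>zeta\<close> is positive.  There may be several trial points, since the
  proximity operator is set-valued for general \<open>fi\<close>.
\<close>

definition trial_points ::
  "('n::finite \<Rightarrow> nat) \<Rightarrow> nat \<Rightarrow> (nat \<Rightarrow> real^'n \<Rightarrow> ereal) \<Rightarrow> (real^'n \<Rightarrow> real) \<Rightarrow>
   (real^'n \<Rightarrow> real) \<Rightarrow> nat \<Rightarrow> real \<Rightarrow> real^'n \<Rightarrow> real^'n \<Rightarrow> (real^'n) set" where
  "trial_points blk N fi h g i \<alpha> x y =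
     (\<lambda>z. replace_block blk i z x) `
       prox (block_space blk i) (\<lambda>z. ereal \<alpha> * fi i z)
         (block blk i x - \<alpha> *\<^sub>R partial_gradient blk i h x
           + (\<alpha> * real_of_ereal (frac_Q (block_sum blk N fi) h g x y)) *\<^sub>R block blk i y)"

text \<open>
  The backtracking: \<open>p l\<close> is the trial point computed with step size \<open>\<alpha> * \<gamma> ^ l\<close>; the trials
  \<open>0, \<dots>, k - 1\<close> are rejected and trial \<open>k\<close> is accepted as \<open>x'\<close>.
\<close>

definition line_search ::
  "('n::finite \<Rightarrow> nat) \<Rightarrow> nat \<Rightarrow> (nat \<Rightarrow> real^'n \<Rightarrow> ereal) \<Rightarrow> (real^'n \<Rightarrow> real) \<Rightarrow>
   (real^'n \<Rightarrow> real) \<Rightarrow> real \<Rightarrow> real \<Rightarrow> nat \<Rightarrow> real \<Rightarrow> real^'n \<Rightarrow> real^'n \<Rightarrow> real^'n \<Rightarrow> bool" where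
  "line_search blk N fi h g \<sigma> \<gamma> i \<alpha> x y x' \<longleftrightarrow>
     (\<exists>k p. (\<forall>l\<le>k. p l \<in> trial_points blk N fi h g i (\<alpha> * \<gamma> ^ l) x y) \<and>
            (\<forall>l<k. \<not> accepts (block_sum blk N fi) h g \<sigma> x y (p l)) \<and>
            accepts (block_sum blk N fi) h g \<sigma> x y (p k) \<and>
            x' = p k)"

text \<open>
  The pair of sequences \<open>x\<close>, \<open>y\<close> is a possible run: the initial step sizes, and the choice among
  several trial points, are arbitrary.
\<close>

definition CMPGA_ML ::
  "('n::finite \<Rightarrow> nat) \<Rightarrow> nat \<Rightarrow> (nat \<Rightarrow> real^'n \<Rightarrow> ereal) \<Rightarrow> (real^'n \<Rightarrow> real) \<Rightarrow>
   (real^'n \<Rightarrow> real) \<Rightarrow> real \<Rightarrow> real \<Rightarrow> real \<Rightarrow> real \<Rightarrow>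
   (nat \<Rightarrow> real^'n) \<Rightarrow> (nat \<Rightarrow> real^'n) \<Rightarrow> bool" where
  "CMPGA_ML blk N fi h g \<alpha>lo \<alpha>hi \<sigma> \<gamma> x y \<longleftrightarrow>
     x 0 \<in> eff_dom (frac_F (block_sum blk N fi) h g) \<and>
     y 0 \<in> convex_subdiff g (x 0) \<and>
     (\<forall>t. \<exists>\<alpha>\<in>{\<alpha>lo..\<alpha>hi}.
        let i = t mod (N + 1) in
        if i = 0
        then x (Suc t) = x t \<and>
             y (Suc t) \<in> prox UNIV (\<lambda>w. ereal \<alpha> * fenchel_conj g w) (y t + \<alpha> *\<^sub>R x t)
        else line_search blk N fi h g \<sigma> \<gamma> i \<alpha> (x t) (y t) (x (Suc t)) \<and> y (Suc t) = y t)"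

definition K_norm :: "nat \<Rightarrow> real^'n::finite \<Rightarrow> real" where
  "K_norm K x =
     sum_list (take K (rev (sorted_list_of_multiset
       (image_mset (\<lambda>j. \<bar>x $ j\<bar>) (mset_set UNIV)))))"

definition box_l1 ::
  "('n::finite \<Rightarrow> nat) \<Rightarrow> real^'n \<Rightarrow> real^'n \<Rightarrow> nat \<Rightarrow> real^'n \<Rightarrow> ereal" where
  "box_l1 blk xlo xhi i z =
     (if \<forall>j. blk j = i \<longrightarrow> xlo $ j \<le> z $ j \<and> z $ j \<le> xhi $ j
      then ereal (\<Sum>j | blk j = i. \<bar>z $ j\<bar>) else \<infinity>)"

definition least_squares :: "real \<Rightarrow> real^'n^'m \<Rightarrow> real^'m \<Rightarrow> real^'n \<Rightarrow> real" where
  "least_squares lam A b x = lam / 2 * (norm (A *v x - b))\<^sup>2"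

end

theory Submission
  imports Defs
begin

text \<open>
  The conjugate of the \<open>K\<close>-norm is the indicator of a polytope \<open>D\<close>, so the merit function is
  \<open>Q(x, y) = \<zeta>(x) / \<langle>x, y\<rangle>\<close> on (box) \<open>\<times> D\<close>.  Along the run it decreases to some \<open>Q\<^sub>*\<close>, in each step
  by at least a multiple of the squared step length.  The function
  \<open>H(x, y) = \<zeta>(x) - Q\<^sub>* \<langle>x, y\<rangle>\<close> is, after an epigraph lift, an indefinite quadratic over a polytope.
  The graph of the normal cone of a polytope is a finite union of polyhedra; on each of them
  stationarity is a linear system, so the distance to its solutions is bounded by the residual \<open>r\<close>
  (Hoffman), and \<open>H\<close> is constant on the solutions.  Hence \<open>H \<le> C r\<^sup>2\<close> as soon as \<open>H\<close> and \<open>r\<close> are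
  small.  With \<open>p\<^sub>k = Q - Q\<^sub>*\<close> at the start of the \<open>k\<close>-th cycle, the residual at the end of the
  cycle is at most a multiple of the movement within the cycle plus \<open>p\<^sub>k\<close>, which
  gives \<open>p\<^bsub>k+1\<^esub> \<le> C (p\<^sub>k - p\<^bsub>k+1\<^esub>) + C p\<^sub>k\<^sup>2\<close>: geometric decay of \<open>p\<close>, hence of the steps.
\<close>

subsection \<open>Error bounds over polyhedra\<close>

text \<open>The bilinear term makes H nonconvex, so a small residual alone says nothing about the
  size of H: there may be stationary points with other values. Each polyhedral piece has at most one
  stationary value, so there are finitely many in all, and the smallness of H discards the pieces
  whose value is not 0. The estimate is uniform over a compact polytope and therefore applies before
  the iterates are known to converge. The summand \<open>p\<^sub>k\<close> in the residual arises
  because the block steps use the current quotient, whereas H is built with its limit; squared, it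
  is of higher order and is absorbed once p is small. The square on the residual fits the descent:
  the squared movement of a cycle is at most a multiple of the decrease of p over that cycle, and H
  at the end of the cycle is the new p times \<langle>x, y\<rangle>. Constants independent of the
  cycle need \<langle>x, y\<rangle> bounded away from 0 and step sizes bounded away from 0 in spite
  of backtracking.\<close>

lemma compact_pos_lower_bound:
  fixes f :: "'a::topological_space \<Rightarrow> real"
  assumes "compact S" "continuous_on S f" "\<And>s. s \<in> S \<Longrightarrow> 0 < f s"
  shows "\<exists>c>0. \<forall>s\<in>S. c \<le> f s"
proof (cases "S = {}")
  case True
  then show ?thesis by (intro exI[of _ 1]) auto
next
  case False
  then obtain m where "m \<in> S" "\<forall>s\<in>S. f m \<le> f s"
    using continuous_attains_inf[OF assms(1) _ assms(2)] by blast
  then show ?thesis using assms(3) by blast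
qed

lemma linear_lower_bound_cone_polar:
  fixes L :: "'a::euclidean_space \<Rightarrow> 'b::euclidean_space" and a :: "'c \<Rightarrow> 'a"
  assumes "linear L"
  shows "\<exists>c>0. \<forall>d. (\<forall>h\<in>J. a h \<bullet> d \<le> 0) \<longrightarrow>
    (\<forall>t. L t = 0 \<longrightarrow> (\<forall>h\<in>J. a h \<bullet> t \<le> 0) \<longrightarrow> d \<bullet> t \<le> 0) \<longrightarrow> c * norm d \<le> norm (L d)"
proof -
  define T where "T = {t. L t = 0 \<and> (\<forall>h\<in>J. a h \<bullet> t \<le> 0)}"
  define S where "S = sphere 0 1 \<inter> (\<Inter>h\<in>J. {d. a h \<bullet> d \<le> 0}) \<inter> (\<Inter>t\<in>T. {d. t \<bullet> d \<le> 0})"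
  have "compact S" unfolding S_def
    by (intro compact_Int_closed compact_sphere closed_INT ballI closed_halfspace_le)
  moreover have "continuous_on S (\<lambda>d. norm (L d))"
    by (intro continuous_intros linear_continuous_on linear_conv_bounded_linear[THEN iffD1] assms)
  moreover have "0 < norm (L d)" if "d \<in> S" for d
  proof (rule ccontr)
    assume "\<not> ?thesis"
    with that have "d \<in> T" by (auto simp: T_def S_def)
    with that have "d \<bullet> d \<le> 0" by (auto simp: S_def)
    with that show False by (simp add: S_def dot_square_norm)
  qed
  ultimately obtain c where c: "c > 0" "\<And>d. d \<in> S \<Longrightarrow> c \<le> norm (L d)"
    using compact_pos_lower_bound by metis
  have "c * norm d \<le> norm (L d)" if d: "\<forall>h\<in>J. a h \<bullet> d \<le> 0"
    "\<forall>t. L t = 0 \<longrightarrow> (\<forall>h\<in>J. a h \<bullet> t \<le> 0) \<longrightarrow> d \<bullet> t \<le> 0" for d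
  proof (cases "d = 0")
    case False
    have "(1 / norm d) *\<^sub>R d \<in> S"
      using d False by (auto simp: S_def T_def inner_commute divide_nonpos_nonneg)
    from c(2)[OF this] have "c \<le> norm (L d) / norm d"
      using assms by (simp add: linear_cmul)
    then show ?thesis using False by (simp add: field_simps)
  qed (use assms in \<open>simp add: linear_0\<close>)
  with c(1) show ?thesis by blast
qed

text \<open>Hoffman's bound. With p the projection of s onto the solution set, s - p has nonpositive
  product with every feasible direction at p, and these directions are exactly the t with L t = 0
  that do not increase an active constraint. The preceding lower bound applies to s - p, and only
  finitely many active sets occur.\<close>

lemma polyhedron_linear_error_bound:
  fixes P :: "'a::euclidean_space set" and L :: "'a \<Rightarrow> 'b::euclidean_space"
  assumes "polyhedron P" "linear L" "s0 \<in> P" "L s0 = l"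
  shows "\<exists>C\<ge>0. \<forall>s\<in>P. \<exists>p\<in>P. L p = l \<and> norm (s - p) \<le> C * norm (L s - l)"
proof -
  obtain F where F: "finite F" "P = \<Inter>F" "\<forall>h\<in>F. \<exists>a b. a \<noteq> 0 \<and> h = {x. a \<bullet> x \<le> b}"
    using assms(1) unfolding polyhedron_def by blast
  then obtain a b where ab: "\<And>h. h \<in> F \<Longrightarrow> h = {x. a h \<bullet> x \<le> b h}" by metis
  have inP: "s \<in> P \<longleftrightarrow> (\<forall>h\<in>F. a h \<bullet> s \<le> b h)" for s
    using F(2) ab by blast
  define good where "good = (\<lambda>c J. \<forall>d. (\<forall>h\<in>J. a h \<bullet> d \<le> 0) \<longrightarrow>
    (\<forall>t. L t = 0 \<longrightarrow> (\<forall>h\<in>J. a h \<bullet> t \<le> 0) \<longrightarrow> d \<bullet> t \<le> 0) \<longrightarrow> c * norm d \<le> norm (L d))"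
  have "\<exists>c>0. good c J" for J
    unfolding good_def by (rule linear_lower_bound_cone_polar[OF assms(2)])
  then obtain c where c: "\<And>J. c J > 0" "\<And>J. good (c J) J" by metis
  \<comment> \<open>One constant for all active sets: a sum of positive terms dominates each of
    them.\<close>
  define C where "C = (\<Sum>J\<in>Pow F. 1 / c J)"
  have C: "1 / c J \<le> C" if "J \<subseteq> F" for J
    unfolding C_def using that F(1) c(1) by (intro member_le_sum) (auto intro: less_imp_le)
  define S where "S = P \<inter> {s. L s = l}"
  have S: "closed S" "convex S" "S \<noteq> {}"
  proof -
    have "closed {s. L s = l}"
      by (intro closed_Collect_eq continuous_intros linear_continuous_on
          linear_conv_bounded_linear[THEN iffD1] assms)
    then show "closed S" unfolding S_def using assms(1) polyhedron_imp_closed by blast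
    have "convex {s. L s = l}" using assms(2)
      by (auto simp: convex_def linear_add linear_cmul simp flip: scaleR_left_distrib)
    then show "convex S" unfolding S_def using assms(1) polyhedron_imp_convex convex_Int by blast
    show "S \<noteq> {}" using assms(3,4) by (auto simp: S_def)
  qed
  have "\<exists>p\<in>P. L p = l \<and> norm (s - p) \<le> C * norm (L s - l)" if s: "s \<in> P" for s
  proof -
    define p where "p = closest_point S s"
    have p: "p \<in> S" using S closest_point_in_set p_def by blast
    define J where "J = {h \<in> F. a h \<bullet> p = b h}"
    have 1: "a h \<bullet> (s - p) \<le> 0" if "h \<in> J" for h
      using that s inP[of s] by (auto simp: J_def inner_diff_right)
    have 2: "(s - p) \<bullet> t \<le> 0" if t: "L t = 0" "\<forall>h\<in>J. a h \<bullet> t \<le> 0" for t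
    proof -
      \<comment> \<open>A short move along t stays in \<open>P\<close>: the active constraints do
        not increase, and the finitely many inactive ones have slack at p.\<close>
      have "\<exists>e>0. \<forall>h\<in>F. a h \<bullet> (p + e *\<^sub>R t) \<le> b h"
      proof -
        have "\<forall>h\<in>F. \<forall>\<^sub>F e in at_right 0. a h \<bullet> (p + e *\<^sub>R t) \<le> b h"
        proof
          fix h assume h: "h \<in> F"
          show "\<forall>\<^sub>F e in at_right 0. a h \<bullet> (p + e *\<^sub>R t) \<le> b h"
          proof (cases "h \<in> J")
            case True
            then have "a h \<bullet> (p + e *\<^sub>R t) \<le> b h" if "e > 0" for e :: real
              using t(2) that by (auto simp: J_def inner_add_right mult_nonneg_nonpos)
            then show ?thesis by (auto simp: eventually_at_right_less intro: eventually_at_rightI[of 0 1])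
          next
            case False
            then have "a h \<bullet> p < b h" using h p inP by (auto simp: J_def S_def less_le)
            moreover have "((\<lambda>e. a h \<bullet> (p + e *\<^sub>R t)) \<longlongrightarrow> a h \<bullet> (p + 0 *\<^sub>R t)) (at_right 0)"
              by (intro tendsto_intros)
            ultimately have "\<forall>\<^sub>F e in at_right 0. a h \<bullet> (p + e *\<^sub>R t) < b h"
              by (intro order_tendstoD(2)) auto
            then show ?thesis by eventually_elim simp
          qed
        qed
        then have "\<forall>\<^sub>F e in at_right 0. \<forall>h\<in>F. a h \<bullet> (p + e *\<^sub>R t) \<le> b h"
          using F(1) by (simp add: eventually_ball_finite_distrib)
        with eventually_at_right_less[of 0]
        have "\<forall>\<^sub>F e in at_right 0. (0::real) < e \<and> (\<forall>h\<in>F. a h \<bullet> (p + e *\<^sub>R t) \<le> b h)"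
          by (rule eventually_conj)
        then show ?thesis using eventually_happens by force
      qed
      then obtain e where e: "e > 0" "p + e *\<^sub>R t \<in> P" using inP by blast
      have "p + e *\<^sub>R t \<in> S" using e p t(1) assms(2) by (auto simp: S_def linear_add linear_cmul)
      from closest_point_dot[OF S(2,1) this, of s]
      have "(s - p) \<bullet> (e *\<^sub>R t) \<le> 0" by (simp add: p_def)
      then show ?thesis using e(1) by (simp add: mult_le_0_iff)
    qed
    have "c J * norm (s - p) \<le> norm (L (s - p))"
      using c(2)[of J] 1 2 unfolding good_def by blast
    moreover have "L (s - p) = L s - l" using p assms(2) by (simp add: S_def linear_diff)
    ultimately have "norm (s - p) \<le> 1 / c J * norm (L s - l)"
      using c(1)[of J] by (simp add: field_simps)
    also have "\<dots> \<le> C * norm (L s - l)"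
      by (rule mult_right_mono[OF C]) (auto simp: J_def)
    finally show ?thesis using p by (auto simp: S_def)
  qed
  moreover have "C \<ge> 0" unfolding C_def by (intro sum_nonneg) (auto intro: less_imp_le c)
  ultimately show ?thesis by blast
qed

text \<open>The difference quotients of q along a segment of \<open>S\<close> are at most a multiple
  of the increment, so the derivative along the segment vanishes.\<close>

lemma quadratic_modulus_imp_constant:
  fixes q :: "'a::real_normed_vector \<Rightarrow> real"
  assumes "convex S" "\<And>z z'. z \<in> S \<Longrightarrow> z' \<in> S \<Longrightarrow> \<bar>q z' - q z\<bar> \<le> M * (norm (z' - z))\<^sup>2"
    and "x \<in> S" "y \<in> S"
  shows "q x = q y"
proof -
  define \<phi> where "\<phi> = (\<lambda>t::real. q (x + t *\<^sub>R (y - x)))"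
  define K where "K = M * (norm (y - x))\<^sup>2"
  have in_S: "x + t *\<^sub>R (y - x) \<in> S" if "t \<in> {0..1}" for t
    using convexD_alt[OF assms(1,3,4), of t] that by (simp add: algebra_simps)
  have bnd: "\<bar>\<phi> t' - \<phi> t\<bar> \<le> K * \<bar>t' - t\<bar> * \<bar>t' - t\<bar>" if "t \<in> {0..1}" "t' \<in> {0..1}" for t t'
  proof -
    have "\<bar>\<phi> t' - \<phi> t\<bar> \<le> M * (norm ((t' - t) *\<^sub>R (y - x)))\<^sup>2"
      using assms(2)[OF in_S[OF that(1)] in_S[OF that(2)]]
      by (simp add: \<phi>_def algebra_simps)
    then show ?thesis by (simp add: K_def power_mult_distrib power2_eq_square mult_ac)
  qed
  have K0: "K \<ge> 0" using bnd[of 0 1] by simp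
  have "(\<phi> has_field_derivative 0) (at t within {0..1})" if t: "t \<in> {0..1}" for t
    unfolding has_field_derivative_iff
  proof (rule Lim_null_comparison)
    show "\<forall>\<^sub>F y in at t within {0..1}. norm ((\<phi> y - \<phi> t) / (y - t)) \<le> K * \<bar>y - t\<bar>"
      unfolding eventually_at_filter
      using bnd[OF t] by (auto intro!: always_eventually simp: divide_simps)
    have "((\<lambda>y. K * \<bar>y - t\<bar>) \<longlongrightarrow> K * \<bar>t - t\<bar>) (at t within {0..1})"
      by (intro tendsto_intros)
    then show "((\<lambda>y. K * \<bar>y - t\<bar>) \<longlongrightarrow> 0) (at t within {0..1})" by simp
  qed
  from has_field_derivative_zero_constant[OF _ this]
  obtain c where "\<forall>t\<in>{0..1}. \<phi> t = c" by auto
  then have "\<phi> 0 = \<phi> 1" by auto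
  then show ?thesis by (simp add: \<phi>_def)
qed

text \<open>\<open>P\<close> plays the part of one piece of the graph of a normal cone, and w + G z
  + g0 is the stationarity residual, affine in (z, w). By \<open>normal\<close>, w may be added to
  the gradient in the expansion of q with the right sign. So q z exceeds the value at a stationary
  point by at most residual times distance plus a multiple of the squared distance, and Hoffman's
  bound replaces the distance by a multiple of the residual.\<close>

lemma affine_variational_error_bound_piece:
  fixes P :: "('a::euclidean_space \<times> 'a) set" and q :: "'a \<Rightarrow> real"
  assumes "polytope P" "linear G"
    and quad: "\<And>z z'. \<bar>q z' - q z - (G z + g0) \<bullet> (z' - z)\<bar> \<le> M * (norm (z' - z))\<^sup>2"
    and normal: "\<And>z w z' w'. (z, w) \<in> P \<Longrightarrow> (z', w') \<in> P \<Longrightarrow> w \<bullet> (z' - z) \<le> 0"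
  shows "\<exists>C\<ge>0. \<exists>e>0. \<forall>z w. (z, w) \<in> P \<longrightarrow> norm (w + G z + g0) < e \<longrightarrow> \<bar>q z - qs\<bar> < e \<longrightarrow>
           q z - qs \<le> C * (norm (w + G z + g0))\<^sup>2"
proof -
  define L where "L = (\<lambda>(z, w). w + G z)"
  have linL: "linear L"
    using assms(2) by (intro linearI) (auto simp: L_def linear_add linear_cmul algebra_simps)
  have decr: "q z - q z' \<le> (w + G z + g0) \<bullet> (z - z') + M * (norm (z - z'))\<^sup>2"
    if "(z, w) \<in> P" "(z', w') \<in> P" for z w z' w'
    using quad[of z' z] normal[OF that]
    by (simp add: inner_diff_right inner_add_left norm_minus_commute abs_if split: if_splits)
  define S where "S = {s \<in> P. L s = - g0}"
  have S0: "w + G z + g0 = 0" if "(z, w) \<in> S" for z w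
    using that by (simp add: S_def L_def)
  show ?thesis
  proof (cases "S = {}")
    case True
    \<comment> \<open>Without stationary points the residual is bounded below on the compact piece,
      so the claim holds vacuously for small e.\<close>
    have "compact P" "polyhedron P" using assms(1) polytope_imp_compact polytope_imp_polyhedron by auto
    moreover have "continuous_on P (\<lambda>s. norm (L s + g0))" using linL
      by (intro continuous_intros linear_continuous_on) (simp add: linear_conv_bounded_linear)
    moreover have "0 < norm (L s + g0)" if "s \<in> P" for s
      using True that by (cases s) (auto simp: S_def add_eq_0_iff2)
    ultimately obtain e where e: "e > 0" "\<forall>s\<in>P. e \<le> norm (L s + g0)"
      using compact_pos_lower_bound[of P "\<lambda>s. norm (L s + g0)"] by blast
    have "\<not> norm (w + G z + g0) < e" if "(z, w) \<in> P" for z w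
      using bspec[OF e(2) that] by (simp add: L_def)
    with e(1) show ?thesis by (intro exI[of _ 0] conjI exI[of _ e]) auto
  next
    case False
    then obtain z0 w0 where s0: "(z0, w0) \<in> S" by auto
    have convS: "convex S"
    proof -
      have "convex {s. L s = - g0}" using linL
        by (auto simp: convex_def linear_add linear_cmul simp flip: scaleR_left_distrib
            scaleR_minus_right scaleR_add_left)
      then have "convex (P \<inter> {s. L s = - g0})"
        using assms(1) polytope_imp_convex convex_Int by blast
      then show ?thesis by (simp add: S_def Int_def)
    qed
    \<comment> \<open>Between two stationary points the residual term vanishes in both directions,
      and only the quadratic remainder is left.\<close>
    have const: "q z = q z0" if "(z, w) \<in> S" for z w
    proof -
      have "\<bar>q (fst s') - q (fst s)\<bar> \<le> \<bar>M\<bar> * (norm (s' - s))\<^sup>2" if "s \<in> S" "s' \<in> S" for s s'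
      proof -
        obtain z w z' w' where s: "s = (z, w)" "s' = (z', w')" by fastforce
        have "q z' - q z \<le> M * (norm (z' - z))\<^sup>2" "q z - q z' \<le> M * (norm (z' - z))\<^sup>2"
          using decr[of z w z' w'] decr[of z' w' z w] S0[of z w] S0[of z' w'] that
          by (auto simp: s S_def norm_minus_commute)
        then have "\<bar>q z' - q z\<bar> \<le> M * (norm (z' - z))\<^sup>2" by simp
        also have "\<dots> \<le> \<bar>M\<bar> * (norm (s' - s))\<^sup>2"
          by (intro mult_mono power_mono) (auto simp: s norm_fst_le)
        finally show ?thesis by (simp add: s)
      qed
      from quadratic_modulus_imp_constant[OF convS this that s0] show ?thesis by simp
    qed
    have "polyhedron P" using assms(1) polytope_imp_polyhedron by auto
    from polyhedron_linear_error_bound[OF this linL, of "(z0, w0)" "- g0"] s0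
    obtain C where C: "C \<ge> 0" "\<forall>s\<in>P. \<exists>p\<in>P. L p = - g0 \<and> norm (s - p) \<le> C * norm (L s + g0)"
      by (auto simp: S_def)
    define K where "K = C + \<bar>M\<bar> * C\<^sup>2"
    have K0: "K \<ge> 0" using C(1) by (simp add: K_def)
    have main: "\<bar>q z - q z0\<bar> \<le> K * (norm (w + G z + g0))\<^sup>2" if zw: "(z, w) \<in> P" for z w
    proof -
      define r where "r = norm (w + G z + g0)"
      obtain z' w' where p: "(z', w') \<in> P" "(z', w') \<in> S" "norm ((z, w) - (z', w')) \<le> C * r"
        using bspec[OF C(2) zw] by (force simp: S_def L_def r_def)
      have d: "norm (z - z') \<le> C * r"
        using p(3) norm_fst_le[of "z - z'" "w - w'"] by auto
      have "M * (norm (z - z'))\<^sup>2 \<le> \<bar>M\<bar> * (C * r)\<^sup>2"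
        using d by (intro mult_mono power_mono) auto
      moreover have "(w + G z + g0) \<bullet> (z - z') \<le> r * (C * r)"
        using norm_cauchy_schwarz[of "w + G z + g0" "z - z'"] mult_left_mono[OF d, of r]
        by (simp add: r_def)
      moreover have "0 \<le> r * (C * r)" using C(1) by (simp add: r_def)
      ultimately have "\<bar>q z - q z'\<bar> \<le> r * (C * r) + \<bar>M\<bar> * (C * r)\<^sup>2"
        using decr[OF zw p(1)] decr[OF p(1) zw] S0[OF p(2)] by (simp add: norm_minus_commute)
      also have "\<dots> = K * r\<^sup>2" by (simp add: K_def power2_eq_square algebra_simps)
      finally show ?thesis using const[OF p(2)] by (simp add: r_def)
    qed
    show ?thesis
    proof (cases "q z0 = qs")
      case True
      then show ?thesis using main K0 by (intro exI[of _ K] conjI exI[of _ 1]) force+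
    next
      case False
      \<comment> \<open>The stationary value of this piece is not \<open>qs\<close>. A residual
        below e \<le> 1 puts q z within K e of q z0; being within e of \<open>qs\<close> as well
        would give \<bar>q z0 - qs\<bar> < (K + 1) e, against the choice of e.\<close>
      define e where "e = min 1 (\<bar>q z0 - qs\<bar> / (K + 1))"
      have e: "e > 0" "e \<le> 1" using False K0 by (auto simp: e_def)
      have "(K + 1) * e \<le> (K + 1) * (\<bar>q z0 - qs\<bar> / (K + 1))"
        using K0 by (intro mult_left_mono) (auto simp: e_def)
      then have e3: "(K + 1) * e \<le> \<bar>q z0 - qs\<bar>" using K0 by simp
      have "\<not> \<bar>q z - qs\<bar> < e" if "(z, w) \<in> P" "norm (w + G z + g0) < e" for z w
      proof
        assume "\<bar>q z - qs\<bar> < e"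
        have "(norm (w + G z + g0))\<^sup>2 \<le> e * 1"
          unfolding power2_eq_square using that e by (intro mult_mono) auto
        then have "K * (norm (w + G z + g0))\<^sup>2 \<le> K * e" using K0 by (auto intro: mult_left_mono)
        with main[OF that(1)] have "\<bar>q z - q z0\<bar> \<le> K * e" by simp
        with \<open>\<bar>q z - qs\<bar> < e\<close> have "\<bar>q z0 - qs\<bar> < K * e + e" by linarith
        with e3 show False by (simp add: algebra_simps)
      qed
      with e(1) show ?thesis by (intro exI[of _ 0] conjI exI[of _ e]) auto
    qed
  qed
qed

text \<open>
  The graph of the normal cone of \<open>convex hull V\<close> is the union over \<open>J \<subseteq> V\<close> of the polyhedra of
  pairs \<open>(z, w)\<close> such that \<open>z \<in> convex hull J\<close> and \<open>w\<close> attains its maximum over \<open>V\<close> on all of \<open>J\<close>.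
\<close>

lemma quadratic_over_polytope_error_bound:
  fixes W :: "'a::euclidean_space set" and q :: "'a \<Rightarrow> real"
  assumes "polytope W" "linear G"
    and quad: "\<And>z z'. \<bar>q z' - q z - (G z + g0) \<bullet> (z' - z)\<bar> \<le> M * (norm (z' - z))\<^sup>2"
  shows "\<exists>C\<ge>0. \<exists>e>0. \<forall>z\<in>W. \<forall>w. (\<forall>z'\<in>W. w \<bullet> (z' - z) \<le> 0) \<longrightarrow> norm (w + G z + g0) < e \<longrightarrow>
           \<bar>q z - qs\<bar> < e \<longrightarrow> q z - qs \<le> C * (norm (w + G z + g0))\<^sup>2"
proof -
  obtain V where V: "finite V" "W = convex hull V"
    using assms(1) unfolding polytope_def by blast
  have "compact ((\<lambda>z. G z + g0) ` W)"
    using assms(1,2) by (intro compact_continuous_image continuous_intros linear_continuous_on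
        linear_conv_bounded_linear[THEN iffD1] polytope_imp_compact)
  then obtain R where R: "\<And>z. z \<in> W \<Longrightarrow> norm (G z + g0) \<le> R"
    using compact_imp_bounded by (fastforce simp: bounded_iff)
  \<comment> \<open>A residual below 1 bounds w by R + 1. Cutting the normal vectors off by a box
    turns each polyhedral piece into a polytope; the 1 inserted into the minimum \<open>e'\<close>
    enforces this bound.\<close>
  obtain a where a: "cball (0::'a) (R + 1) \<subseteq> cbox (- a) a"
    using bounded_subset_cbox_symmetric[OF bounded_cball] by blast
  define Q where "Q = (\<lambda>J. cbox (- a) a \<inter> (\<Inter>v\<in>J. \<Inter>v'\<in>V. {w. (v' - v) \<bullet> w \<le> 0}))"
  have "\<exists>C e. C \<ge> 0 \<and> e > 0 \<and> (\<forall>z w. (z, w) \<in> (convex hull J) \<times> Q J \<longrightarrow> norm (w + G z + g0) < e \<longrightarrow>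
     \<bar>q z - qs\<bar> < e \<longrightarrow> q z - qs \<le> C * (norm (w + G z + g0))\<^sup>2)" if J: "J \<subseteq> V" for J
  proof -
    have fJ: "finite J" using J V(1) finite_subset by blast
    have "polytope ((convex hull J) \<times> Q J)"
    proof (rule polytope_Times)
      show "polytope (convex hull J)" using fJ by (rule polytope_convex_hull)
      have "polyhedron (\<Inter>v\<in>J. \<Inter>v'\<in>V. {w. (v' - v) \<bullet> w \<le> 0})"
        using fJ V(1) by (intro polyhedron_Inter) (auto intro!: polyhedron_Inter polyhedron_halfspace_le)
      then show "polytope (Q J)"
        unfolding Q_def by (intro polytope_Int_polyhedron polytope_interval)
    qed
    moreover have "w \<bullet> (z' - z) \<le> 0"
      if "(z, w) \<in> (convex hull J) \<times> Q J" "(z', w') \<in> (convex hull J) \<times> Q J" for z w z' w'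
    proof -
      have "convex hull J \<subseteq> {x. w \<bullet> x \<le> w \<bullet> v}" if "v \<in> J" for v
        using J \<open>(z, w) \<in> _\<close> that
        by (intro hull_minimal convex_halfspace_le) (auto simp: Q_def inner_diff_left inner_diff_right inner_commute)
      then have "J \<subseteq> {x. w \<bullet> x \<ge> w \<bullet> z'}" using that(2) by auto
      then have "convex hull J \<subseteq> {x. w \<bullet> x \<ge> w \<bullet> z'}"
        by (intro hull_minimal convex_halfspace_ge)
      then show ?thesis using that(1) by (auto simp: inner_diff_right)
    qed
    ultimately show ?thesis
      using affine_variational_error_bound_piece[OF _ assms(2) quad, of "(convex hull J) \<times> Q J" qs] by blast
  qed
  then obtain C e where Ce: "\<And>J. J \<subseteq> V \<Longrightarrow> C J \<ge> 0" "\<And>J. J \<subseteq> V \<Longrightarrow> e J > 0"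
    "\<And>J z w. J \<subseteq> V \<Longrightarrow> (z, w) \<in> (convex hull J) \<times> Q J \<Longrightarrow> norm (w + G z + g0) < e J \<Longrightarrow>
     \<bar>q z - qs\<bar> < e J \<Longrightarrow> q z - qs \<le> C J * (norm (w + G z + g0))\<^sup>2"
    by metis
  define C' where "C' = (\<Sum>J\<in>Pow V. C J)"
  define e' where "e' = Min (insert 1 (e ` Pow V))"
  have C': "C J \<le> C'" if "J \<subseteq> V" for J
    unfolding C'_def using that V(1) Ce(1) by (intro member_le_sum) auto
  have e': "e' > 0" "e' \<le> 1" "\<And>J. J \<subseteq> V \<Longrightarrow> e' \<le> e J"
    using V(1) Ce(2) by (auto simp: e'_def)
  have "q z - qs \<le> C' * (norm (w + G z + g0))\<^sup>2"
    if z: "z \<in> W" and w: "\<forall>z'\<in>W. w \<bullet> (z' - z) \<le> 0" and r: "norm (w + G z + g0) < e'" "\<bar>q z - qs\<bar> < e'"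
    for z w
  proof -
    obtain u where u: "\<forall>v\<in>V. 0 \<le> u v" "sum u V = 1" "(\<Sum>v\<in>V. u v *\<^sub>R v) = z"
      using z V by (auto simp: convex_hull_finite)
    \<comment> \<open>w \<bullet> z is an average of numbers w \<bullet> v \<le> w \<bullet> z, so
      every vertex with nonzero weight attains the maximum of w; this places (z, w) in the piece of
      \<open>J\<close>.\<close>
    define J where "J = {v \<in> V. u v \<noteq> 0}"
    have J: "J \<subseteq> V" "finite J" using V(1) by (auto simp: J_def)
    have le: "w \<bullet> v \<le> w \<bullet> z" if "v \<in> V" for v
      using w that V(2) hull_inc[of v V] by (auto simp: inner_diff_right)
    have "w \<bullet> z = (\<Sum>v\<in>V. u v * (w \<bullet> v))"
      by (simp add: u(3)[symmetric] inner_sum_right)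
    then have "(\<Sum>v\<in>V. u v * (w \<bullet> z - w \<bullet> v)) = 0"
      by (simp add: right_diff_distrib sum_subtractf u(2) flip: sum_distrib_right)
    then have "\<forall>v\<in>V. u v * (w \<bullet> z - w \<bullet> v) = 0"
      using u(1) le V(1) by (subst (asm) sum_nonneg_eq_0_iff) auto
    then have eq: "w \<bullet> v = w \<bullet> z" if "v \<in> J" for v using that by (auto simp: J_def)
    have "sum u J = 1" "(\<Sum>v\<in>J. u v *\<^sub>R v) = z"
      unfolding u(2,3)[symmetric] using V(1) by (auto simp: J_def intro!: sum.mono_neutral_left)
    then have "z \<in> convex hull J" using u(1) J by (auto simp: convex_hull_finite[OF J(2)])
    moreover have "norm w \<le> R + 1"
      using norm_triangle_ineq4[of "w + G z + g0" "G z + g0"] R[OF z] r(1) e'(2) by (simp add: add.assoc)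
    then have "w \<in> Q J"
      using a eq le by (auto simp: Q_def inner_diff_left inner_diff_right inner_commute subset_iff)
    ultimately have "q z - qs \<le> C J * (norm (w + G z + g0))\<^sup>2"
      using Ce(3)[OF J(1)] r e'(3)[OF J(1)] by force
    also have "\<dots> \<le> C' * (norm (w + G z + g0))\<^sup>2" by (intro mult_right_mono C' J) auto
    finally show ?thesis .
  qed
  moreover have "C' \<ge> 0" unfolding C'_def using Ce(1) by (intro sum_nonneg) auto
  ultimately show ?thesis using e'(1) by blast
qed

subsection \<open>The lifted parametric objective\<close>

definition l1_norm :: "real^'n::finite \<Rightarrow> real" where
  "l1_norm x = (\<Sum>j\<in>UNIV. \<bar>x $ j\<bar>)"

definition least_squares_grad :: "real \<Rightarrow> real^'n^'m \<Rightarrow> real^'m \<Rightarrow> real^'n \<Rightarrow> real^'n" where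
  "least_squares_grad lam A b x = lam *\<^sub>R (transpose A *v (A *v x - b))"

declare transpose_matrix_vector [simp del]

lemma inner_transpose_mult: "(transpose A *v u) \<bullet> x = u \<bullet> (A *v x)"
  for A :: "real^'n^'m" and u :: "real^'m" and x :: "real^'n"
  by (simp add: transpose_matrix_vector dot_lmul_matrix)

lemma least_squares_expand:
  "least_squares lam A b z = least_squares lam A b x + least_squares_grad lam A b x \<bullet> (z - x)
     + lam / 2 * (norm (A *v (z - x)))\<^sup>2"
proof -
  have "A *v z - b = (A *v x - b) + A *v (z - x)"
    by (simp add: matrix_vector_mult_diff_distrib)
  moreover have "(norm (u + v))\<^sup>2 = (norm u)\<^sup>2 + 2 * (u \<bullet> v) + (norm v)\<^sup>2" for u v :: "real^'m"
    by (simp add: power2_norm_eq_inner inner_add_left inner_add_right inner_commute)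
  ultimately have "(norm (A *v z - b))\<^sup>2 = (norm (A *v x - b))\<^sup>2
      + 2 * ((A *v x - b) \<bullet> (A *v (z - x))) + (norm (A *v (z - x)))\<^sup>2"
    by metis
  then show ?thesis
    unfolding least_squares_def least_squares_grad_def inner_scaleR_left inner_transpose_mult
    by (simp add: distrib_left)
qed

lemma least_squares_grad_diff:
  "least_squares_grad lam A b z - least_squares_grad lam A b x = lam *\<^sub>R (transpose A *v (A *v (z - x)))"
  by (simp add: least_squares_grad_def algebra_simps matrix_vector_mult_diff_distrib)

lemma gradient_least_squares:
  fixes x :: "real^'n"
  shows "gradient (least_squares lam A b) x = least_squares_grad lam A b x"
proof -
  have lin: "bounded_linear (\<lambda>h. A *v h)" by (rule matrix_vector_mul_bounded_linear)
  have "((\<lambda>x. lam / 2 * ((A *v x - b) \<bullet> (A *v x - b))) has_derivative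
     (\<lambda>h. lam / 2 * ((A *v x - b) \<bullet> (A *v h) + (A *v h) \<bullet> (A *v x - b)))) (at x)"
    by (auto intro!: derivative_eq_intros bounded_linear.has_derivative[OF lin])
  moreover have "lam / 2 * ((A *v x - b) \<bullet> (A *v h) + (A *v h) \<bullet> (A *v x - b)) =
     h \<bullet> least_squares_grad lam A b x" for h
    unfolding inner_commute[of h] inner_commute[of "A *v h"]
    by (simp add: least_squares_grad_def inner_transpose_mult)
  ultimately have "GDERIV (least_squares lam A b) x :> least_squares_grad lam A b x"
    by (simp add: gderiv_def least_squares_def[abs_def] power2_norm_eq_inner)
  moreover have "D = D'" if "GDERIV h x :> D" "GDERIV h x :> D'" for h :: "real^'n \<Rightarrow> real" and D D'
    using has_derivative_unique[OF that[unfolded gderiv_def]]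
    by (metis inner_commute vector_eq_ldot)
  ultimately show ?thesis unfolding gradient_def by blast
qed

lemma continuous_on_l1_norm [continuous_intros]:
  "continuous_on S f \<Longrightarrow> continuous_on S (\<lambda>x. l1_norm (f x))"
  unfolding l1_norm_def by (intro continuous_intros)

lemma l1_norm_nonneg: "0 \<le> l1_norm x"
  unfolding l1_norm_def by (intro sum_nonneg) auto

text \<open>The norm is the maximum of finitely many linear functionals, \<open>S\<close> being the
  set of coordinates that get the sign +1. Hence its epigraph is a polyhedron.\<close>

lemma l1_norm_le_iff:
  "l1_norm x \<le> t \<longleftrightarrow> (\<forall>S. (\<chi> j. if j \<in> S then 1 else - 1) \<bullet> x \<le> t)"
proof
  assume "l1_norm x \<le> t"
  moreover have "(\<chi> j. if j \<in> S then 1 else - 1) \<bullet> x \<le> l1_norm x" for S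
    unfolding l1_norm_def inner_vec_def by (rule sum_mono) auto
  ultimately show "\<forall>S. (\<chi> j. if j \<in> S then 1 else - 1) \<bullet> x \<le> t"
    using order_trans by blast
next
  assume "\<forall>S. (\<chi> j. if j \<in> S then 1 else - 1) \<bullet> x \<le> t"
  then have "(\<chi> j. if j \<in> {j. x $ j \<ge> 0} then 1 else - 1) \<bullet> x \<le> t" by blast
  moreover have "(\<chi> j. if j \<in> {j. x $ j \<ge> 0} then 1 else - 1) \<bullet> x = l1_norm x"
    unfolding l1_norm_def inner_vec_def by (rule sum.cong) auto
  ultimately show "l1_norm x \<le> t" by simp
qed

lemma polytope_l1_epigraph:
  fixes lo hi :: "real^'n"
  shows "polytope {p. fst p \<in> cbox lo hi \<and> l1_norm (fst p) \<le> snd p \<and> snd p \<le> M}"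
proof -
  let ?s = "\<lambda>S. (\<chi> j. if j \<in> S then 1 else - 1) :: real^'n"
  \<comment> \<open>The halfspaces already force the epigraph variable to be nonnegative, so it can
    be confined to the interval from 0 to M.\<close>
  have "0 \<le> t" if "\<forall>S. ?s S \<bullet> x \<le> t" for x t
    using that l1_norm_nonneg[of x] by (simp flip: l1_norm_le_iff)
  then have "{p. fst p \<in> cbox lo hi \<and> l1_norm (fst p) \<le> snd p \<and> snd p \<le> M} =
     (cbox lo hi \<times> cbox 0 M) \<inter> (\<Inter>S. {p. (?s S, -1) \<bullet> p \<le> 0})"
    by (auto simp: l1_norm_le_iff)
  moreover have "polyhedron (\<Inter>S. {p. (?s S, -1::real) \<bullet> p \<le> 0})"
    by (intro polyhedron_Inter) (auto intro: polyhedron_halfspace_le)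
  moreover have "polytope (cbox lo hi \<times> cbox 0 M)"
    by (intro polytope_Times polytope_interval)
  ultimately show ?thesis
    by (simp only: polytope_Int_polyhedron)
qed

text \<open>
  Replacing the \<open>\<ell>\<^sub>1\<close>-norm by an epigraph variable turns the parametric objective
  \<open>\<zeta>(x) - c \<langle>x, y\<rangle>\<close> into a quadratic function on a polytope.
\<close>

lemma l1_least_squares_error_bound:
  fixes A :: "real^'n^'m" and D :: "(real^'n) set"
  assumes "polytope D"
  shows "\<exists>C\<ge>0. \<exists>e>0. \<forall>x\<in>cbox lo hi. \<forall>y\<in>D. \<forall>\<xi> w.
     (\<forall>z\<in>cbox lo hi. l1_norm x + \<xi> \<bullet> (z - x) \<le> l1_norm z) \<longrightarrow>
     (\<forall>y'\<in>D. w \<bullet> (y' - y) \<le> 0) \<longrightarrow>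
     norm (\<xi> + least_squares_grad lam A b x - c *\<^sub>R y) + norm (w - c *\<^sub>R x) < e \<longrightarrow>
     \<bar>l1_norm x + least_squares lam A b x - c * (x \<bullet> y)\<bar> < e \<longrightarrow>
     l1_norm x + least_squares lam A b x - c * (x \<bullet> y) \<le>
       C * (norm (\<xi> + least_squares_grad lam A b x - c *\<^sub>R y) + norm (w - c *\<^sub>R x))\<^sup>2"
proof -
  have "compact (l1_norm ` cbox lo hi)"
    by (intro compact_continuous_image continuous_intros compact_cbox)
  then have "bounded (l1_norm ` cbox lo hi)" by (rule compact_imp_bounded)
  then obtain T where "\<forall>s\<in>l1_norm ` cbox lo hi. norm s \<le> T"
    unfolding bounded_iff ..
  then have T: "\<And>x. x \<in> cbox lo hi \<Longrightarrow> l1_norm x \<le> T" by force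
  \<comment> \<open>Truncation at \<open>T\<close> bounds the epigraph but keeps every point (x,
    \<open>l1_norm x\<close>) over the box.\<close>
  define E where "E = {p. fst p \<in> cbox lo hi \<and> l1_norm (fst p) \<le> snd p \<and> snd p \<le> T}"
  define q where "q = (\<lambda>((x, t), y). t + least_squares lam A b x - c * (x \<bullet> y))"
  \<comment> \<open>\<open>G\<close> and \<open>g0\<close> are the linear and the constant part of
    the gradient of \<open>q\<close>; the entry 1 in \<open>g0\<close> is the derivative in the
    epigraph variable.\<close>
  define G where "G = (\<lambda>((x::real^'n, t::real), y::real^'n).
     ((lam *\<^sub>R (transpose A *v (A *v x)) - c *\<^sub>R y, 0::real), - (c *\<^sub>R x)))"
  define g0 where "g0 = ((- (lam *\<^sub>R (transpose A *v b)), 1::real), 0::real^'n)"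
  obtain B where B: "B > 0" "\<And>d. norm (A *v d) \<le> norm d * B"
    using bounded_linear.pos_bounded[OF matrix_vector_mul_bounded_linear[of A]] by blast
  \<comment> \<open>Second-order remainder: the first summand comes from the least-squares term, the
    second from the bilinear term.\<close>
  define M where "M = \<bar>lam / 2\<bar> * B\<^sup>2 + \<bar>c\<bar>"
  have "polytope (E \<times> D)" unfolding E_def by (intro polytope_Times polytope_l1_epigraph assms)
  moreover have "linear G"
    by (rule linearI) (auto simp: G_def algebra_simps matrix_vector_mult_scaleR)
  moreover have "\<bar>q z' - q z - (G z + g0) \<bullet> (z' - z)\<bar> \<le> M * (norm (z' - z))\<^sup>2" for z z'
  proof -
    obtain x t y x' t' y' where z: "z = ((x, t), y)" "z' = ((x', t'), y')" by (metis surj_pair)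
    have Gz: "G z + g0 = ((least_squares_grad lam A b x - c *\<^sub>R y, 1), - (c *\<^sub>R x))"
      by (simp add: z G_def g0_def least_squares_grad_def algebra_simps matrix_vector_mult_diff_distrib)
    have "q z' - q z - (G z + g0) \<bullet> (z' - z) =
        lam / 2 * (norm (A *v (x' - x)))\<^sup>2 - c * ((x' - x) \<bullet> (y' - y))"
      unfolding Gz using least_squares_expand[of lam A b x' x]
      by (simp add: z q_def inner_diff_left inner_diff_right algebra_simps inner_commute)
    also have "\<bar>\<dots>\<bar> \<le> \<bar>lam / 2 * (norm (A *v (x' - x)))\<^sup>2\<bar> + \<bar>c * ((x' - x) \<bullet> (y' - y))\<bar>"
      by (rule abs_triangle_ineq4)
    also have "\<dots> \<le> \<bar>lam / 2\<bar> * (B\<^sup>2 * (norm (z' - z))\<^sup>2) + \<bar>c\<bar> * (norm (z' - z) * norm (z' - z))"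
    proof (rule add_mono)
      have n: "norm (x' - x) \<le> norm (z' - z)" "norm (y' - y) \<le> norm (z' - z)"
        using norm_fst_le[of "x' - x" "t' - t"] norm_fst_le[of "(x' - x, t' - t)" "y' - y"]
          norm_snd_le[of "y' - y" "(x' - x, t' - t)"] by (auto simp: z)
      have "norm (A *v (x' - x)) \<le> B * norm (z' - z)"
        using order_trans[OF B(2) mult_right_mono[OF n(1)]] B(1) by (simp add: mult.commute)
      then have "(norm (A *v (x' - x)))\<^sup>2 \<le> (B * norm (z' - z))\<^sup>2" by (intro power_mono) auto
      then show "\<bar>lam / 2 * (norm (A *v (x' - x)))\<^sup>2\<bar> \<le> \<bar>lam / 2\<bar> * (B\<^sup>2 * (norm (z' - z))\<^sup>2)"
        by (simp add: abs_mult power_mult_distrib mult_left_mono)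
      have "\<bar>(x' - x) \<bullet> (y' - y)\<bar> \<le> norm (z' - z) * norm (z' - z)"
        by (rule order_trans[OF Cauchy_Schwarz_ineq2]) (intro mult_mono n norm_ge_zero)
      then show "\<bar>c * ((x' - x) \<bullet> (y' - y))\<bar> \<le> \<bar>c\<bar> * (norm (z' - z) * norm (z' - z))"
        by (simp add: abs_mult mult_left_mono)
    qed
    also have "\<dots> = M * (norm (z' - z))\<^sup>2" by (simp add: M_def power2_eq_square algebra_simps)
    finally show ?thesis .
  qed
  ultimately obtain C e where C: "C \<ge> 0" "e > 0"
    "\<forall>z\<in>E \<times> D. \<forall>w. (\<forall>z'\<in>E \<times> D. w \<bullet> (z' - z) \<le> 0) \<longrightarrow> norm (w + G z + g0) < e \<longrightarrow>
       \<bar>q z - 0\<bar> < e \<longrightarrow> q z - 0 \<le> C * (norm (w + G z + g0))\<^sup>2"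
    using quadratic_over_polytope_error_bound[of "E \<times> D" G q g0 M 0] by blast
  have "l1_norm x + least_squares lam A b x - c * (x \<bullet> y) \<le>
       C * (norm (\<xi> + least_squares_grad lam A b x - c *\<^sub>R y) + norm (w - c *\<^sub>R x))\<^sup>2"
    if x: "x \<in> cbox lo hi" "y \<in> D" and \<xi>: "\<forall>z\<in>cbox lo hi. l1_norm x + \<xi> \<bullet> (z - x) \<le> l1_norm z"
      and w: "\<forall>y'\<in>D. w \<bullet> (y' - y) \<le> 0"
      and r: "norm (\<xi> + least_squares_grad lam A b x - c *\<^sub>R y) + norm (w - c *\<^sub>R x) < e"
        "\<bar>l1_norm x + least_squares lam A b x - c * (x \<bullet> y)\<bar> < e" for x y \<xi> w
  proof -
    \<comment> \<open>A subgradient \<xi> at x is a normal vector (\<xi>, -1) to the epigraph at the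
      graph point. Its last entry cancels the derivative 1 in the epigraph variable, so the lift
      adds nothing to the residual.\<close>
    let ?z = "((x, l1_norm x), y)" and ?w = "((\<xi>, - 1), w)"
    have zE: "?z \<in> E \<times> D" using x T by (auto simp: E_def)
    have normal: "\<forall>z'\<in>E \<times> D. ?w \<bullet> (z' - ?z) \<le> 0"
    proof
      fix z' assume z': "z' \<in> E \<times> D"
      obtain x' t' y' where z: "z' = ((x', t'), y')" by (metis surj_pair)
      have "l1_norm x + \<xi> \<bullet> (x' - x) \<le> t'" "w \<bullet> (y' - y) \<le> 0"
        using z' \<xi> w by (force simp: z E_def)+
      then show "?w \<bullet> (z' - ?z) \<le> 0" by (simp add: z)
    qed
    have res: "?w + G ?z + g0 =
        ((\<xi> + least_squares_grad lam A b x - c *\<^sub>R y, 0), w - c *\<^sub>R x)"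
      by (simp add: G_def g0_def least_squares_grad_def algebra_simps matrix_vector_mult_diff_distrib)
    have nres: "norm (?w + G ?z + g0) \<le>
        norm (\<xi> + least_squares_grad lam A b x - c *\<^sub>R y) + norm (w - c *\<^sub>R x)"
      unfolding res norm_Pair using sqrt_sum_squares_le_sum_abs[of "norm (\<xi> + least_squares_grad lam A b x - c *\<^sub>R y)" "norm (w - c *\<^sub>R x)"]
      by simp
    have "q ?z - 0 \<le> C * (norm (?w + G ?z + g0))\<^sup>2"
      using nres r by (intro C(3)[rule_format, OF zE] normal[rule_format]) (simp_all add: q_def)
    also have "\<dots> \<le> C * (norm (\<xi> + least_squares_grad lam A b x - c *\<^sub>R y) + norm (w - c *\<^sub>R x))\<^sup>2"
      by (intro mult_left_mono power_mono nres C(1)) auto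
    finally show ?thesis by (simp add: q_def)
  qed
  with C(1,2) show ?thesis by blast
qed

subsection \<open>The \<open>K\<close>-norm and its conjugate\<close>

text \<open>Sorting the indices instead of the values turns the list sum into a sum over a set
  \<open>T\<close> of K indices whose entries dominate all others. For another K-element set S, the
  differences S - T and T - S have equally many elements, and the least absolute value \<theta> on T
  separates the entries on them.\<close>

lemma K_norm_eq_sum_largest:
  fixes x :: "real^'n"
  assumes "1 \<le> K" "K \<le> CARD('n)"
  obtains S where "card S = K" "K_norm K x = (\<Sum>j\<in>S. \<bar>x $ j\<bar>)"
    "\<And>S'. card S' = K \<Longrightarrow> (\<Sum>j\<in>S'. \<bar>x $ j\<bar>) \<le> K_norm K x"
proof -
  let ?f = "\<lambda>j. \<bar>x $ j\<bar>"
  obtain js :: "'n list" where js: "set js = UNIV" "distinct js"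
    using finite_distinct_list[of "UNIV :: 'n set"] by auto
  define ys where "ys = rev (sort_key ?f js)"
  have ys: "set ys = UNIV" "distinct ys" "length ys = CARD('n)"
    using js distinct_card[of js] by (simp_all add: ys_def)
  have "mset js = mset_set UNIV" using js by (metis mset_set_set)
  then have "sorted_list_of_multiset (image_mset ?f (mset_set UNIV)) = sort (map ?f js)"
    by (metis mset_map sorted_list_of_multiset_mset)
  also have "\<dots> = map ?f (sort_key ?f js)"
    by (rule properties_for_sort) simp_all
  finally have eq: "K_norm K x = sum_list (map ?f (take K ys))"
    by (simp add: K_norm_def ys_def rev_map take_map)
  define T where "T = set (take K ys)"
  have K: "K_norm K x = sum ?f T"
    using ys(2) unfolding eq T_def by (simp add: sum_list_distinct_conv_sum_set)
  have cT: "card T = K"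
    using ys assms(2) distinct_card[of "take K ys"] by (simp add: T_def)
  have sorted: "sorted (rev (map ?f ys))" by (simp add: ys_def rev_map)
  have le: "?f b \<le> ?f a" if "a \<in> T" "b \<notin> T" for a b
  proof -
    obtain i where i: "i < K" "i < length ys" "a = ys ! i"
      using \<open>a \<in> T\<close> by (auto simp: T_def in_set_conv_nth)
    obtain k where k: "k < length ys" "b = ys ! k" using ys(1) by (metis UNIV_I in_set_conv_nth)
    have "\<not> k < K" using that(2) k by (auto simp: T_def in_set_conv_nth)
    then show ?thesis
      using sorted i k unfolding sorted_rev_iff_nth_mono by (auto dest!: spec[of _ i] spec[of _ k])
  qed
  have "sum ?f S \<le> sum ?f T" if S: "card S = K" for S
  proof -
    have "T \<noteq> {}" using cT assms(1) by auto
    define \<theta> where "\<theta> = Min (?f ` T)"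
    have \<theta>: "\<theta> \<in> ?f ` T" "\<And>a. a \<in> T \<Longrightarrow> \<theta> \<le> ?f a"
      using \<open>T \<noteq> {}\<close> unfolding \<theta>_def by (auto intro!: Min_in simp del: Min_in)
    have card: "card (S - T) = card (T - S)"
      using S cT card_Diff_subset_Int[of S T] card_Diff_subset_Int[of T S] by (simp add: Int_commute)
    have "sum ?f (S - T) \<le> of_nat (card (S - T)) * \<theta>"
      using \<theta>(1) le by (intro sum_bounded_above) auto
    also have "\<dots> \<le> sum ?f (T - S)"
      unfolding card using \<theta>(2) by (intro sum_bounded_below) auto
    finally show ?thesis
      using sum.Int_Diff[of S ?f T] sum.Int_Diff[of T ?f S] by (simp add: Int_commute)
  qed
  with that[of T] K cT show thesis by simp
qed

text \<open>\<open>S\<close> is the support and \<open>T\<close> marks the entries +1. For 1 \<le> K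
  \<le> n, maximizing the product with x over these vectors selects the K largest absolute values,
  so their hull is the unit ball of the dual of the K-norm; the description by vertices makes it a
  polytope at once.\<close>

definition sparse_sign_vectors :: "nat \<Rightarrow> (real^'n) set" where
  "sparse_sign_vectors K =
     (\<lambda>(S, T). \<chi> j. if j \<in> S then if j \<in> T then 1 else - 1 else 0) ` {(S, T). card S = K}"

lemma finite_sparse_sign_vectors: "finite (sparse_sign_vectors K :: (real^'n) set)"
  unfolding sparse_sign_vectors_def by (rule finite_imageI) (rule finite)

abbreviation dual_ball :: "nat \<Rightarrow> (real^'n) set" where
  "dual_ball K \<equiv> convex hull (sparse_sign_vectors K)"

context
  fixes K :: nat
  assumes K: "1 \<le> K" "K \<le> CARD('n::finite)"
begin

lemma K_norm_nonneg: "0 \<le> K_norm K (x::real^'n)"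
  using K_norm_eq_sum_largest[OF K, of x] by (metis abs_ge_zero sum_nonneg)

lemma inner_le_K_norm:
  fixes x y :: "real^'n"
  assumes "y \<in> dual_ball K"
  shows "x \<bullet> y \<le> K_norm K x"
proof -
  have "x \<bullet> v \<le> K_norm K x" if "v \<in> sparse_sign_vectors K" for v
  proof -
    obtain S T where v: "card S = K" "v = (\<chi> j. if j \<in> S then if j \<in> T then 1 else - 1 else 0)"
      using \<open>v \<in> sparse_sign_vectors K\<close> by (auto simp: sparse_sign_vectors_def)
    have "x \<bullet> v = (\<Sum>j\<in>S. x $ j * v $ j)"
      unfolding inner_vec_def inner_real_def by (rule sum.mono_neutral_right) (auto simp: v)
    also have "\<dots> \<le> (\<Sum>j\<in>S. \<bar>x $ j\<bar>)" by (rule sum_mono) (auto simp: v)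
    also have "\<dots> \<le> K_norm K x" using v(1) K_norm_eq_sum_largest[OF K, of x] by metis
    finally show ?thesis .
  qed
  then have "dual_ball K \<subseteq> {y. x \<bullet> y \<le> K_norm K x}"
    by (intro hull_minimal convex_halfspace_le) auto
  with assms show ?thesis by auto
qed

lemma K_norm_attained:
  fixes x :: "real^'n"
  obtains v where "v \<in> dual_ball K" "x \<bullet> v = K_norm K x"
proof -
  obtain S where S: "card S = K" "K_norm K x = (\<Sum>j\<in>S. \<bar>x $ j\<bar>)"
    using K_norm_eq_sum_largest[OF K, of x] by metis
  define v :: "real^'n" where "v = (\<chi> j. if j \<in> S then if j \<in> {j. 0 \<le> x $ j} then 1 else - 1 else 0)"
  have "v \<in> sparse_sign_vectors K"
    unfolding sparse_sign_vectors_def v_def using S(1) by (intro image_eqI[of _ _ "(S, {j. 0 \<le> x $ j})"]) auto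
  then have "v \<in> dual_ball K" by (rule hull_inc)
  moreover have "x \<bullet> v = (\<Sum>j\<in>S. x $ j * v $ j)"
    unfolding inner_vec_def inner_real_def by (rule sum.mono_neutral_right) (auto simp: v_def)
  then have "x \<bullet> v = K_norm K x"
    unfolding S(2) by (simp add: v_def cong: sum.cong) (rule sum.cong, auto)
  ultimately show thesis by (rule that)
qed

lemma K_norm_zero: "K_norm K (0::real^'n) = 0"
  using K_norm_attained[of 0] by (metis inner_zero_left)

text \<open>The K-norm is the support function of the ball. Inside the ball the supremum is attained
  at 0; for y outside, a separating hyperplane with normal a makes the expression grow linearly
  along -a.\<close>

lemma fenchel_conj_K_norm:
  fixes y :: "real^'n"
  shows "fenchel_conj (K_norm K) y = (if y \<in> dual_ball K then 0 else \<infinity>)"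
proof (cases "y \<in> dual_ball K")
  case True
  have "fenchel_conj (K_norm K) y \<le> 0"
    unfolding fenchel_conj_def using inner_le_K_norm[OF True] by (intro SUP_least) auto
  moreover have "ereal (0 \<bullet> y - K_norm K (0::real^'n)) \<le> fenchel_conj (K_norm K) y"
    unfolding fenchel_conj_def by (rule SUP_upper2[where i = 0]) auto
  ultimately show ?thesis using True by (auto simp: K_norm_zero zero_ereal_def intro: antisym)
next
  case False
  have "closed (dual_ball K :: (real^'n) set)"
    by (intro compact_imp_closed finite_imp_compact_convex_hull finite_sparse_sign_vectors)
  with False obtain a \<beta> where ab: "a \<bullet> y < \<beta>" "\<forall>v\<in>dual_ball K. a \<bullet> v > \<beta>"
    using separating_hyperplane_closed_point[of "dual_ball K" y] by (auto simp: convex_convex_hull)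
  have "\<exists>x. ereal (real n) \<le> ereal (x \<bullet> y - K_norm K x)" for n
  proof -
    \<comment> \<open>Scaled so that s times the separation gap \<beta> - a \<bullet> y is exactly
      n, whence the supremum exceeds every n.\<close>
    define s where "s = real n / (\<beta> - a \<bullet> y)"
    have s: "s \<ge> 0" "s * (\<beta> - a \<bullet> y) = real n" using ab(1) by (auto simp: s_def)
    obtain v where v: "v \<in> dual_ball K" "(- s *\<^sub>R a) \<bullet> v = K_norm K (- s *\<^sub>R a)"
      using K_norm_attained[of "- s *\<^sub>R a"] by metis
    have "real n \<le> s * (a \<bullet> v - a \<bullet> y)"
      unfolding s(2)[symmetric] using ab(2) v(1) s(1) by (intro mult_left_mono) force+
    also have "\<dots> = (- s *\<^sub>R a) \<bullet> y - K_norm K (- s *\<^sub>R a)"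
      unfolding v(2)[symmetric] by (simp add: algebra_simps)
    finally show ?thesis by (intro exI[of _ "- s *\<^sub>R a"]) simp
  qed
  then have "fenchel_conj (K_norm K) y = \<infinity>"
    unfolding fenchel_conj_def by (intro SUP_PInfty) auto
  with False show ?thesis by simp
qed

lemma eff_dom_fenchel_conj_K_norm: "eff_dom (fenchel_conj (K_norm K)) = (dual_ball K :: (real^'n) set)"
  by (auto simp: eff_dom_def fenchel_conj_K_norm split: if_splits)

text \<open>The subgradient inequality bounds the conjugate at y, which places y in the ball; its
  instance at the point 0 yields the equality.\<close>

lemma convex_subdiff_K_norm:
  "convex_subdiff (K_norm K) (x::real^'n) = {y \<in> dual_ball K. x \<bullet> y = K_norm K x}"
proof (intro equalityI subsetI)
  fix y assume y: "y \<in> convex_subdiff (K_norm K) x"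
  then have sub: "K_norm K x + y \<bullet> (z - x) \<le> K_norm K z" for z by (auto simp: convex_subdiff_def)
  have "fenchel_conj (K_norm K) y \<le> ereal (y \<bullet> x - K_norm K x)"
    unfolding fenchel_conj_def
  proof (rule SUP_least)
    show "ereal (z \<bullet> y - K_norm K z) \<le> ereal (y \<bullet> x - K_norm K x)" for z
      using sub[of z] by (simp add: inner_diff_right inner_commute)
  qed
  then have "y \<in> dual_ball K" by (auto simp: fenchel_conj_K_norm split: if_splits)
  moreover have "K_norm K x \<le> x \<bullet> y" using sub[of 0] by (simp add: K_norm_zero inner_commute)
  ultimately show "y \<in> {y \<in> dual_ball K. x \<bullet> y = K_norm K x}"
    using inner_le_K_norm[of y x] by auto
next
  fix y assume "y \<in> {y \<in> dual_ball K. x \<bullet> y = K_norm K x}"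
  then show "y \<in> convex_subdiff (K_norm K) x"
    using inner_le_K_norm[of y] by (auto simp: convex_subdiff_def inner_diff_right inner_commute)
qed

lemma eta_K_norm:
  fixes x y :: "real^'n"
  assumes "y \<in> dual_ball K"
  shows "eta (K_norm K) x y = ereal (x \<bullet> y)"
  using assms by (simp add: eta_def fenchel_conj_K_norm)

end

subsection \<open>Geometric sequences\<close>

lemma norm_diff_le_geometric:
  fixes u :: "nat \<Rightarrow> 'a::real_normed_vector"
  assumes "0 < \<theta>" "\<theta> < 1" "\<And>t. norm (u (Suc t) - u t) \<le> C * \<theta> ^ t"
  shows "norm (u (t + k) - u t) \<le> C / (1 - \<theta>) * \<theta> ^ t"
proof -
  have C: "0 \<le> C" using order_trans[OF norm_ge_zero assms(3)[of 0]] by simp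
  have "norm (u (t + k) - u t) \<le> C * \<theta> ^ t * (\<Sum>i<k. \<theta> ^ i)"
  proof (induction k)
    case (Suc k)
    have "norm (u (t + Suc k) - u t) \<le> norm (u (Suc (t + k)) - u (t + k)) + norm (u (t + k) - u t)"
      using norm_triangle_ineq[of "u (Suc (t + k)) - u (t + k)" "u (t + k) - u t"] by simp
    also have "\<dots> \<le> C * \<theta> ^ (t + k) + C * \<theta> ^ t * (\<Sum>i<k. \<theta> ^ i)"
      by (rule add_mono[OF assms(3) Suc])
    finally show ?case by (simp add: algebra_simps power_add)
  qed simp
  also have "(\<Sum>i<k. \<theta> ^ i) \<le> 1 / (1 - \<theta>)"
    using assms(1,2) by (simp add: sum_gp_strict divide_right_mono)
  then have "C * \<theta> ^ t * (\<Sum>i<k. \<theta> ^ i) \<le> C * \<theta> ^ t * (1 / (1 - \<theta>))"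
    using C assms(1) by (intro mult_left_mono) auto
  finally show ?thesis by (simp add: mult_ac)
qed

lemma geometric_steps_converge:
  fixes u :: "nat \<Rightarrow> 'a::banach"
  assumes "0 < \<theta>" "\<theta> < 1" "\<And>t. norm (u (Suc t) - u t) \<le> C * \<theta> ^ t"
  obtains l where "u \<longlonglongrightarrow> l" "\<And>t. norm (u t - l) \<le> C / (1 - \<theta>) * \<theta> ^ t"
proof -
  have lim0: "(\<lambda>t. C / (1 - \<theta>) * \<theta> ^ t) \<longlonglongrightarrow> 0"
    using tendsto_mult_right_zero[OF LIMSEQ_power_zero[of \<theta>]] assms(1,2) by auto
  have "Cauchy u"
  proof (rule CauchyI')
    fix e :: real assume "e > 0"
    from order_tendstoD(2)[OF lim0 this] obtain M where M: "\<forall>t\<ge>M. C / (1 - \<theta>) * \<theta> ^ t < e"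
      by (auto simp: eventually_sequentially)
    have "dist (u m) (u n) < e" if "m \<ge> M" "n > m" for m n
      using norm_diff_le_geometric[OF assms, of m "n - m"] M that
      by (fastforce simp: dist_norm norm_minus_commute)
    then show "\<exists>M. \<forall>m\<ge>M. \<forall>n>m. dist (u m) (u n) < e" by blast
  qed
  then obtain l where l: "u \<longlonglongrightarrow> l" using Cauchy_convergent convergent_def by blast
  have "norm (u t - l) \<le> C / (1 - \<theta>) * \<theta> ^ t" for t
  proof (rule LIMSEQ_le_const2)
    show "(\<lambda>k. norm (u t - u (k + t))) \<longlonglongrightarrow> norm (u t - l)"
      by (intro tendsto_intros LIMSEQ_ignore_initial_segment l)
    show "\<exists>N. \<forall>k\<ge>N. norm (u t - u (k + t)) \<le> C / (1 - \<theta>) * \<theta> ^ t"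
      using norm_diff_le_geometric[OF assms, of t] by (auto simp: norm_minus_commute add.commute)
  qed
  with l show thesis by (rule that)
qed

text \<open>Once C p k < 1/2, the quadratic term is at most half of p k, and moving C p (Suc k) to
  the left leaves (C + 1) p (Suc k) \<le> (C + 1/2) p k. This is the origin of \<rho>.\<close>

lemma quadratic_recursion_geometric:
  fixes p :: "nat \<Rightarrow> real"
  assumes "p \<longlonglongrightarrow> 0" "\<And>k. 0 \<le> p k" "0 \<le> C"
    and rec: "\<And>k. k \<ge> k0 \<Longrightarrow> p (Suc k) \<le> C * (p k - p (Suc k)) + C * (p k)\<^sup>2"
  obtains B \<rho> where "0 < \<rho>" "\<rho> < 1" "0 \<le> B" "\<And>k. p k \<le> B * \<rho> ^ k"
proof -
  have "(\<lambda>k. C * p k) \<longlonglongrightarrow> 0" using tendsto_mult_right_zero[OF assms(1)] by simp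
  then have "eventually (\<lambda>k. C * p k < 1/2) sequentially" by (rule order_tendstoD(2)) simp
  then obtain k1 where k1: "\<And>k. k \<ge> k1 \<Longrightarrow> C * p k < 1/2" by (auto simp: eventually_sequentially)
  define m where "m = max k0 k1"
  define \<rho> where "\<rho> = (C + 1/2) / (C + 1)"
  have \<rho>: "0 < \<rho>" "\<rho> < 1" using assms(3) by (auto simp: \<rho>_def)
  have step: "p (Suc k) \<le> \<rho> * p k" if "k \<ge> m" for k
  proof -
    have "C * (p k)\<^sup>2 \<le> 1/2 * p k"
      using mult_right_mono[OF less_imp_le[OF k1[of k]] assms(2)[of k]] that
      by (simp add: m_def power2_eq_square mult.assoc)
    then have "(C + 1) * p (Suc k) \<le> (C + 1/2) * p k"
      using rec[of k] that by (simp add: m_def algebra_simps)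
    then show ?thesis using assms(3) by (simp add: \<rho>_def field_simps)
  qed
  have tail: "p (m + k) \<le> p m * \<rho> ^ k" for k
  proof (induction k)
    case (Suc k)
    have "p (Suc (m + k)) \<le> \<rho> * (p m * \<rho> ^ k)"
      using order_trans[OF step[of "m + k"] mult_left_mono[OF Suc, of \<rho>]] \<rho>(1) by simp
    then show ?case by (simp add: mult_ac)
  qed simp
  define B where "B = (\<Sum>k\<le>m. p k) / \<rho> ^ m"
  have B: "0 \<le> B" unfolding B_def using assms(2) \<rho> by (intro divide_nonneg_pos sum_nonneg) auto
  have mem: "p k \<le> B * \<rho> ^ m" if "k \<le> m" for k
    using that member_le_sum[of k "{..m}" p] assms(2) \<rho>(1) by (simp add: B_def)
  have "p k \<le> B * \<rho> ^ k" for k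
  proof (cases "k \<le> m")
    case True
    have "B * \<rho> ^ m \<le> B * \<rho> ^ k" using True \<rho> B by (intro mult_left_mono power_decreasing) auto
    with mem[OF True] show ?thesis by simp
  next
    case False
    have "p k \<le> p m * \<rho> ^ (k - m)" using tail[of "k - m"] False by simp
    also have "\<dots> \<le> B * \<rho> ^ m * \<rho> ^ (k - m)" using mem[of m] \<rho> by (intro mult_right_mono) auto
    also have "\<dots> = B * \<rho> ^ k" using False by (simp flip: power_add)
    finally show ?thesis .
  qed
  with \<rho> B show thesis by (rule that)
qed

text \<open>Turns a rate per cycle of n steps into a rate per step; the division by \<rho> pays for
  the unfinished last cycle.\<close>

lemma power_div_le_root_power:
  fixes \<rho> :: real
  assumes "0 < \<rho>" "\<rho> < 1" "0 < n"
  shows "\<rho> ^ (t div n) \<le> root n \<rho> ^ t / \<rho>"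
proof -
  define \<tau> where "\<tau> = root n \<rho>"
  have \<tau>: "0 < \<tau>" "\<tau> < 1" "\<tau> ^ n = \<rho>" using assms by (auto simp: \<tau>_def)
  have "\<rho> ^ (t div n) * \<rho> = \<tau> ^ (n * (t div n) + n)"
    by (simp add: power_add power_mult \<tau>(3))
  also have "\<dots> \<le> \<tau> ^ t"
  proof (rule power_decreasing)
    show "t \<le> n * (t div n) + n"
      using mult_div_mod_eq[of n t] mod_less_divisor[OF assms(3), of t] by linarith
  qed (use \<tau> in auto)
  finally show ?thesis using assms(1) by (simp add: \<tau>_def field_simps)
qed

text \<open>Minimality is tested at the points of the segment from z to w. After division by the
  parameter s, the quadratic term contributes s / 2 times the squared distance, which vanishes as s
  tends to 0.\<close>

lemma convex_prox_subgradient: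
  fixes \<phi> :: "'a::real_inner \<Rightarrow> real"
  assumes "convex_on S \<phi>" "z \<in> S" "w \<in> S"
    and min: "\<And>w. w \<in> S \<Longrightarrow> \<phi> z + 1/2 * (norm (z - v))\<^sup>2 \<le> \<phi> w + 1/2 * (norm (w - v))\<^sup>2"
  shows "\<phi> z + (v - z) \<bullet> (w - z) \<le> \<phi> w"
proof -
  have "\<phi> z + (v - z) \<bullet> (w - z) - \<phi> w \<le> s / 2 * (norm (w - z))\<^sup>2" if s: "0 < s" "s < 1" for s
  proof -
    let ?w = "(1 - s) *\<^sub>R z + s *\<^sub>R w"
    have "?w \<in> S" using assms(1-3) s by (auto simp: convex_on_def convex_alt)
    then have "\<phi> z + 1/2 * (norm (z - v))\<^sup>2 \<le> \<phi> ?w + 1/2 * (norm (?w - v))\<^sup>2" by (rule min)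
    moreover have "\<phi> ?w \<le> (1 - s) * \<phi> z + s * \<phi> w"
      using convex_onD[OF assms(1), of s z w] assms(2,3) s by simp
    moreover have "(norm (?w - v))\<^sup>2 = (norm (z - v))\<^sup>2 - 2 * s * ((v - z) \<bullet> (w - z)) + s\<^sup>2 * (norm (w - z))\<^sup>2"
    proof -
      have "?w - v = s *\<^sub>R (w - z) - (v - z)" by (simp add: algebra_simps)
      moreover have "(norm (s *\<^sub>R d - a))\<^sup>2 = (norm a)\<^sup>2 - 2 * s * (a \<bullet> d) + s\<^sup>2 * (norm d)\<^sup>2" for a d :: 'a
        unfolding power2_norm_eq_inner
        by (simp add: inner_diff_left inner_diff_right inner_commute power2_eq_square algebra_simps)
      ultimately show ?thesis by (metis norm_minus_commute)
    qed
    ultimately have "s * (\<phi> z + (v - z) \<bullet> (w - z) - \<phi> w) \<le> s * (s / 2 * (norm (w - z))\<^sup>2)"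
      by (simp add: algebra_simps power2_eq_square)
    then show ?thesis using s(1) by simp
  qed
  then have "\<forall>\<^sub>F s in at_right 0. \<phi> z + (v - z) \<bullet> (w - z) - \<phi> w \<le> s / 2 * (norm (w - z))\<^sup>2"
    by (intro eventually_at_rightI[of 0 1]) auto
  moreover have "((\<lambda>s. s / 2 * (norm (w - z))\<^sup>2) \<longlongrightarrow> 0 / 2 * (norm (w - z))\<^sup>2) (at_right 0)"
    by (intro tendsto_intros) auto
  ultimately have "\<phi> z + (v - z) \<bullet> (w - z) - \<phi> w \<le> 0 / 2 * (norm (w - z))\<^sup>2"
    by (intro tendsto_lowerbound) (auto simp: trivial_limit_at_right_real)
  then show ?thesis by simp
qed

subsection \<open>Cyclic descent\<close>

lemma norm_diff_le_sum_steps: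
  fixes u :: "nat \<Rightarrow> 'a::real_normed_vector"
  assumes "s \<le> n"
  shows "norm (u (a + n) - u (a + s)) \<le> (\<Sum>i<n. norm (u (Suc (a + i)) - u (a + i)))"
proof -
  have "norm (u (a + n) - u (a + s)) \<le> (\<Sum>i\<in>{s..<n}. norm (u (Suc (a + i)) - u (a + i)))"
    using assms
  proof (induction n rule: dec_induct)
    case (step m)
    have "norm (u (a + Suc m) - u (a + s)) \<le> norm (u (Suc (a + m)) - u (a + m)) + norm (u (a + m) - u (a + s))"
      using norm_triangle_ineq[of "u (Suc (a + m)) - u (a + m)" "u (a + m) - u (a + s)"] by simp
    with step show ?case by simp
  qed simp
  also have "\<dots> \<le> (\<Sum>i<n. norm (u (Suc (a + i)) - u (a + i)))"
    by (rule sum_mono2) auto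
  finally show ?thesis .
qed

lemma least_squares_grad_lipschitz:
  fixes A :: "real^'n^'m"
  obtains L where "0 \<le> L"
    "\<And>z x. norm (least_squares_grad lam A b z - least_squares_grad lam A b x) \<le> L * norm (z - x)"
proof -
  have "bounded_linear (\<lambda>d. lam *\<^sub>R (transpose A *v (A *v d)))"
    by (intro bounded_linear_scaleR_right[THEN bounded_linear_compose]
        matrix_vector_mul_bounded_linear[THEN bounded_linear_compose] matrix_vector_mul_bounded_linear)
  from bounded_linear.nonneg_bounded[OF this]
  obtain L where "0 \<le> L" "\<And>d. norm (lam *\<^sub>R (transpose A *v (A *v d))) \<le> norm d * L" by blast
  then show thesis
    by (intro that[of L]) (simp_all add: least_squares_grad_diff mult.commute)
qed

section \<open>The run as a real-valued descent scheme\<close>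

definition l1_least_squares :: "real \<Rightarrow> real^'n^'m \<Rightarrow> real^'m \<Rightarrow> real^'n \<Rightarrow> real" where
  "l1_least_squares lam A b x = l1_norm x + least_squares lam A b x"

lemma continuous_on_l1_least_squares: "continuous_on S (l1_least_squares lam A b)"
proof -
  have "continuous_on S (\<lambda>x. A *v x)"
    by (intro linear_continuous_on matrix_vector_mul_bounded_linear)
  then show ?thesis
    unfolding l1_least_squares_def least_squares_def
    by (intro continuous_on_add continuous_on_mult continuous_on_power continuous_on_norm
        continuous_on_diff continuous_on_const continuous_on_l1_norm continuous_on_id)
qed

lemma l1_least_squares_pos:
  assumes "b \<noteq> 0" "0 < lam"
  shows "0 < l1_least_squares lam A b x"
proof (cases "x = 0")
  case True
  with assms show ?thesis
    by (simp add: l1_least_squares_def l1_norm_def least_squares_def)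
next
  case False
  then obtain j where "x $ j \<noteq> 0" by (auto simp: vec_eq_iff)
  then have "0 < l1_norm x" unfolding l1_norm_def by (intro sum_pos2[of _ j]) auto
  then show ?thesis using assms(2) by (simp add: l1_least_squares_def least_squares_def add_pos_nonneg)
qed

text \<open>What remains of a run once extended reals, proximal maps and backtracking are resolved.
  The y-step is the variational inequality of a projection onto \<open>D\<close>. The x-step is
  stated coordinate by coordinate, which is possible because the box and the l1-norm are separable;
  inequalities from different times can then be joined into one vector. \<alpha>lo bounds the
  accepted step sizes, not only the initial ones.\<close>

locale cyclic_descent =
  fixes A :: "real^'n^'m" and b :: "real^'m" and lam \<alpha>lo \<alpha>hi \<sigma> :: real
    and lo hi :: "real^'n" and D :: "(real^'n) set" and blk :: "'n \<Rightarrow> nat" and N :: nat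
    and x y :: "nat \<Rightarrow> real^'n" and Q :: "nat \<Rightarrow> real"
  assumes b: "b \<noteq> 0" and lam: "0 < lam" and \<alpha>lo: "0 < \<alpha>lo" and \<sigma>: "0 < \<sigma>"
    and D: "polytope D" and blk: "blk j \<in> {1..N}"
    and x_in: "x t \<in> cbox lo hi" and y_in: "y t \<in> D" and inner_pos: "0 < x t \<bullet> y t"
    and Q_eq: "Q t = l1_least_squares lam A b (x t) / (x t \<bullet> y t)"
    and y_step: "t mod Suc N = 0 \<Longrightarrow> x (Suc t) = x t \<and>
      (\<exists>\<alpha>\<in>{\<alpha>lo..\<alpha>hi}. \<forall>y'\<in>D. (y t + \<alpha> *\<^sub>R x t - y (Suc t)) \<bullet> (y' - y (Suc t)) \<le> 0)"
    and x_step_y: "t mod Suc N \<noteq> 0 \<Longrightarrow> y (Suc t) = y t"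
    and x_step_block: "t mod Suc N \<noteq> 0 \<Longrightarrow> blk j \<noteq> t mod Suc N \<Longrightarrow> x (Suc t) $ j = x t $ j"
    and x_step_subgrad: "t mod Suc N \<noteq> 0 \<Longrightarrow>
      \<exists>\<alpha>\<ge>\<alpha>lo. \<forall>j. blk j = t mod Suc N \<longrightarrow> (\<forall>s\<in>{lo $ j..hi $ j}. \<bar>x (Suc t) $ j\<bar> +
        ((x t - x (Suc t)) $ j / \<alpha> - least_squares_grad lam A b (x t) $ j + Q t * y t $ j)
          * (s - x (Suc t) $ j) \<le> \<bar>s\<bar>)"
    and x_step_descent: "t mod Suc N \<noteq> 0 \<Longrightarrow> l1_least_squares lam A b (x (Suc t)) +
        \<sigma> / 2 * (norm (x (Suc t) - x t))\<^sup>2 \<le> Q t * (x (Suc t) \<bullet> y t)"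
begin

abbreviation \<zeta> where "\<zeta> \<equiv> l1_least_squares lam A b"

abbreviation grad where "grad \<equiv> least_squares_grad lam A b"

lemma bounds:
  obtains m M where "0 < m" "0 < M" "\<And>z. z \<in> cbox lo hi \<Longrightarrow> m \<le> \<zeta> z"
    "\<And>z. z \<in> cbox lo hi \<Longrightarrow> norm z \<le> M" "\<And>v. v \<in> D \<Longrightarrow> norm v \<le> M"
    "\<And>z v. z \<in> cbox lo hi \<Longrightarrow> v \<in> D \<Longrightarrow> z \<bullet> v \<le> M\<^sup>2"
proof -
  obtain m where m: "0 < m" "\<forall>z\<in>cbox lo hi. m \<le> \<zeta> z"
    using compact_pos_lower_bound[OF compact_cbox continuous_on_l1_least_squares] l1_least_squares_pos[OF b lam]
    by metis
  have "bounded (cbox lo hi \<union> D)"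
    using D by (simp add: polytope_imp_bounded)
  then obtain M where M: "0 < M" "\<forall>z\<in>cbox lo hi \<union> D. norm z \<le> M" unfolding bounded_pos by blast
  moreover have "z \<bullet> v \<le> M\<^sup>2" if "z \<in> cbox lo hi" "v \<in> D" for z v
    using order_trans[OF norm_cauchy_schwarz mult_mono[of "norm z" M "norm v" M]] M that
    by (simp add: power2_eq_square)
  ultimately show thesis using m by (intro that[of m M]) auto
qed

lemma Q_pos: "0 < Q t"
  using inner_pos[of t] l1_least_squares_pos[OF b lam, of A "x t"] by (simp add: Q_eq)

lemma zeta_eq: "\<zeta> (x t) = Q t * (x t \<bullet> y t)"
  using inner_pos[of t] by (simp add: Q_eq)

text \<open>In a y-step the numerator is fixed and the projection inequality raises the denominator
  by at least the squared movement divided by \<alpha>; bounds on numerator and denominators turn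
  this into a drop of Q. In an x-step the drop is the descent inequality divided by the new
  denominator, which is at most M squared. \<kappa> is the smaller of the two factors.\<close>

lemma sufficient_decrease:
  obtains \<kappa> where "0 < \<kappa>"
    "\<And>t. \<kappa> * ((norm (x (Suc t) - x t))\<^sup>2 + (norm (y (Suc t) - y t))\<^sup>2) \<le> Q t - Q (Suc t)"
proof -
  obtain m M where M: "0 < m" "0 < M" "\<And>z. z \<in> cbox lo hi \<Longrightarrow> m \<le> \<zeta> z"
    "\<And>z v. z \<in> cbox lo hi \<Longrightarrow> v \<in> D \<Longrightarrow> z \<bullet> v \<le> M\<^sup>2"
    using bounds by metis
  \<comment> \<open>Time 0 is a y-step, and its step size lies between \<alpha>lo and
    \<alpha>hi.\<close>
  have a: "0 < \<alpha>hi" using y_step[of 0] \<alpha>lo by auto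
  define \<kappa> where "\<kappa> = min (\<sigma> / (2 * M\<^sup>2)) (m / (\<alpha>hi * (M\<^sup>2 * M\<^sup>2)))"
  have "0 < \<kappa>" using M \<sigma> a by (simp add: \<kappa>_def)
  moreover have "\<kappa> * ((norm (x (Suc t) - x t))\<^sup>2 + (norm (y (Suc t) - y t))\<^sup>2) \<le> Q t - Q (Suc t)" for t
  proof (cases "t mod Suc N = 0")
    case True
    from y_step[OF True] obtain \<alpha> where \<alpha>: "x (Suc t) = x t" "\<alpha>lo \<le> \<alpha>" "\<alpha> \<le> \<alpha>hi"
      "\<forall>y'\<in>D. (y t + \<alpha> *\<^sub>R x t - y (Suc t)) \<bullet> (y' - y (Suc t)) \<le> 0" by auto
    define e e' where "e = x t \<bullet> y t" and "e' = x t \<bullet> y (Suc t)"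
    have e: "0 < e" "0 < e'" "e \<le> M\<^sup>2" "e' \<le> M\<^sup>2"
      using inner_pos[of t] inner_pos[of "Suc t"] M(4)[OF x_in y_in] \<alpha>(1) by (auto simp: e_def e'_def)
    define d where "d = (norm (y (Suc t) - y t))\<^sup>2"
    have "d \<le> \<alpha> * (e' - e)"
      using bspec[OF \<alpha>(4) y_in[of t]]
      by (simp add: d_def e_def e'_def power2_norm_eq_inner algebra_simps inner_commute)
    moreover have "0 \<le> d" by (simp add: d_def)
    ultimately have "0 \<le> e' - e" using \<alpha>(2) \<alpha>lo by (smt (verit) zero_le_mult_iff)
    with \<open>d \<le> \<alpha> * (e' - e)\<close> \<alpha>(3) have d: "d \<le> \<alpha>hi * (e' - e)"
      by (meson mult_right_mono order_trans)
    have "\<kappa> * d \<le> m / (\<alpha>hi * (M\<^sup>2 * M\<^sup>2)) * (\<alpha>hi * (e' - e))"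
      using d \<open>0 \<le> d\<close> M a by (intro mult_mono) (auto simp: \<kappa>_def)
    also have "\<dots> = (e' - e) * (m / (M\<^sup>2 * M\<^sup>2))" using a by simp
    also have "\<dots> \<le> (e' - e) * (\<zeta> (x t) / (e * e'))"
      using e M(3)[OF x_in] M(1) \<open>0 \<le> e' - e\<close>
      by (intro mult_left_mono frac_le mult_mono) (auto intro: order_trans[OF less_imp_le])
    also have "\<dots> = Q t - Q (Suc t)"
      using e \<alpha>(1) by (simp add: Q_eq e_def[symmetric] e'_def[symmetric] field_simps)
    finally show ?thesis using \<alpha>(1) by (simp add: d_def)
  next
    case False
    define e' where "e' = x (Suc t) \<bullet> y t"
    have e': "0 < e'" "e' \<le> M\<^sup>2"
      using inner_pos[of "Suc t"] M(4)[OF x_in y_in] x_step_y[OF False] by (auto simp: e'_def)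
    define d where "d = (norm (x (Suc t) - x t))\<^sup>2"
    have "\<kappa> * d \<le> \<sigma> / (2 * M\<^sup>2) * d" by (intro mult_right_mono) (auto simp: \<kappa>_def d_def)
    also have "\<dots> \<le> \<sigma> / (2 * e') * d"
      using e' \<sigma> M(2) by (intro mult_right_mono divide_left_mono) (auto simp: d_def)
    also have "\<dots> \<le> Q t - Q (Suc t)"
      using x_step_descent[OF False] e' x_step_y[OF False]
      by (simp add: Q_eq[of "Suc t"] e'_def[symmetric] d_def[symmetric] field_simps)
    finally show ?thesis using x_step_y[OF False] by (simp add: d_def)
  qed
  ultimately show thesis by (rule that)
qed

section \<open>Monotonicity and limits along the run\<close>

lemma Q_Suc_le: "Q (Suc t) \<le> Q t"
proof -
  obtain \<kappa> where \<kappa>: "0 < \<kappa>"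
    "\<kappa> * ((norm (x (Suc t) - x t))\<^sup>2 + (norm (y (Suc t) - y t))\<^sup>2) \<le> Q t - Q (Suc t)"
    using sufficient_decrease by metis
  have "0 \<le> \<kappa> * ((norm (x (Suc t) - x t))\<^sup>2 + (norm (y (Suc t) - y t))\<^sup>2)"
    using \<kappa>(1) by (intro mult_nonneg_nonneg) auto
  with \<kappa>(2) show ?thesis by linarith
qed

lemma Q_antimono: "s \<le> t \<Longrightarrow> Q t \<le> Q s"
  using Q_Suc_le by (rule lift_Suc_antimono_le[of Q])

lemma Q_limit:
  obtains Qs where "0 < Qs" "Q \<longlonglongrightarrow> Qs" "\<And>t. Qs \<le> Q t"
proof -
  obtain m M where M: "0 < m" "0 < M" "\<And>z. z \<in> cbox lo hi \<Longrightarrow> m \<le> \<zeta> z"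
    "\<And>z v. z \<in> cbox lo hi \<Longrightarrow> v \<in> D \<Longrightarrow> z \<bullet> v \<le> M\<^sup>2"
    using bounds by metis
  have lb: "m / M\<^sup>2 \<le> Q t" for t
    unfolding Q_eq using M inner_pos[of t] x_in[of t] y_in[of t]
    by (intro frac_le) (auto intro: order_trans[OF less_imp_le])
  have "decseq Q" by (rule decseq_SucI) (rule Q_Suc_le)
  then obtain Qs where Qs: "Q \<longlonglongrightarrow> Qs" "\<And>t. Qs \<le> Q t"
    using decseq_convergent[of Q "m / M\<^sup>2"] lb by blast
  have "m / M\<^sup>2 \<le> Qs" using lb by (intro LIMSEQ_le_const[OF Qs(1)]) auto
  moreover have "0 < m / M\<^sup>2" using M by simp
  ultimately show thesis using Qs by (intro that) auto
qed

text \<open>The numerator is bounded below on the box and the quotient never exceeds its initial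
  value, so the denominator cannot tend to 0. This keeps the limit point in the domain and lets H
  control the gap of Q.\<close>

lemma inner_lower_bound:
  obtains \<mu> where "0 < \<mu>" "\<And>t. \<mu> \<le> x t \<bullet> y t"
proof -
  obtain m M where m: "0 < m" "\<And>z. z \<in> cbox lo hi \<Longrightarrow> m \<le> \<zeta> z" using bounds by metis
  have "m / Q 0 \<le> x t \<bullet> y t" for t
  proof -
    have "m \<le> Q t * (x t \<bullet> y t)" using m(2)[OF x_in] by (simp add: zeta_eq)
    also have "\<dots> \<le> Q 0 * (x t \<bullet> y t)"
      using Q_antimono[of 0 t] inner_pos[of t] by (intro mult_right_mono) auto
    finally show ?thesis using Q_pos[of 0] by (simp add: field_simps)
  qed
  moreover have "0 < m / Q 0" using m(1) Q_pos[of 0] by simp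
  ultimately show thesis using that by blast
qed

text \<open>Cycle k starts at time Suc N * k: the step at offset 0 moves y, the step at offset s
  \<ge> 1 moves block s.\<close>

definition cycle_length :: "nat \<Rightarrow> real" where
  "cycle_length k = (\<Sum>s<Suc N. norm (x (Suc (Suc N * k + s)) - x (Suc N * k + s))
                               + norm (y (Suc (Suc N * k + s)) - y (Suc N * k + s)))"

lemma cycle_length_nonneg: "0 \<le> cycle_length k"
  unfolding cycle_length_def by (intro sum_nonneg) auto

lemma cycle_step_le:
  assumes "s < Suc N"
  shows "norm (x (Suc (Suc N * k + s)) - x (Suc N * k + s)) \<le> cycle_length k"
    "norm (y (Suc (Suc N * k + s)) - y (Suc N * k + s)) \<le> cycle_length k"
proof -
  have "norm (x (Suc (Suc N * k + s)) - x (Suc N * k + s)) + norm (y (Suc (Suc N * k + s)) - y (Suc N * k + s))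
      \<le> cycle_length k"
    unfolding cycle_length_def using assms
    by (intro member_le_sum[of s "{..<Suc N}" "\<lambda>s. norm (x (Suc (Suc N * k + s)) - x (Suc N * k + s))
         + norm (y (Suc (Suc N * k + s)) - y (Suc N * k + s))"]) auto
  then show "norm (x (Suc (Suc N * k + s)) - x (Suc N * k + s)) \<le> cycle_length k"
    "norm (y (Suc (Suc N * k + s)) - y (Suc N * k + s)) \<le> cycle_length k"
    by (smt (verit) norm_ge_zero)+
qed

lemma cycle_x_diff_le:
  assumes "s \<le> Suc N"
  shows "norm (x (Suc N * Suc k) - x (Suc N * k + s)) \<le> cycle_length k"
proof -
  have eq: "Suc N * Suc k = Suc N * k + Suc N" by simp
  have "norm (x (Suc N * Suc k) - x (Suc N * k + s))
      \<le> (\<Sum>i<Suc N. norm (x (Suc (Suc N * k + i)) - x (Suc N * k + i)))"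
    unfolding eq by (rule norm_diff_le_sum_steps[OF assms])
  also have "\<dots> \<le> cycle_length k" unfolding cycle_length_def by (intro sum_mono) auto
  finally show ?thesis .
qed

lemma cycle_mod: "s < Suc N \<Longrightarrow> (Suc N * k + s) mod Suc N = s"
  by (simp only: mod_mult_self4 mod_less)

lemma cycle_end_x:
  "x (Suc N * Suc k) $ j = x (Suc (Suc N * k + blk j)) $ j"
proof -
  have "x (Suc N * k + s) $ j = x (Suc (Suc N * k + blk j)) $ j" if "Suc (blk j) \<le> s" "s \<le> Suc N" for s
    using that
  proof (induction s rule: dec_induct)
    case (step s)
    then show ?case using x_step_block[of "Suc N * k + s" j] cycle_mod[of s k] by simp
  qed simp
  from this[of "Suc N"] blk[of j] show ?thesis by (simp add: add.commute)
qed

lemma cycle_y: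
  assumes "1 \<le> s" "s \<le> Suc N"
  shows "y (Suc N * k + s) = y (Suc N * Suc k)"
proof -
  have "y (Suc N * k + s) = y (Suc N * k + 1)" if "1 \<le> s" "s \<le> Suc N" for s
    using that
  proof (induction s rule: dec_induct)
    case (step s)
    then show ?case using x_step_y[of "Suc N * k + s"] cycle_mod[of s k] by simp
  qed simp
  from this[OF assms] this[of "Suc N"] show ?thesis by (simp add: add.commute)
qed

text \<open>
  A block does not move after its own step, so the optimality conditions of the individual
  subproblems survive to the end of the cycle up to the movement within the cycle.
\<close>

lemma cycle_residual:
  assumes Qs: "0 \<le> Qs" "\<And>t. Qs \<le> Q t"
  obtains C where "0 \<le> C" "\<And>k. \<exists>\<xi> w.
    (\<forall>z\<in>cbox lo hi. l1_norm (x (Suc N * Suc k)) + \<xi> \<bullet> (z - x (Suc N * Suc k)) \<le> l1_norm z) \<and>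
    (\<forall>y'\<in>D. w \<bullet> (y' - y (Suc N * Suc k)) \<le> 0) \<and>
    norm (\<xi> + grad (x (Suc N * Suc k)) - Qs *\<^sub>R y (Suc N * Suc k)) + norm (w - Qs *\<^sub>R x (Suc N * Suc k))
      \<le> C * (cycle_length k + (Q (Suc N * k) - Qs))"
proof -
  obtain L where L: "0 \<le> L" "\<And>z x. norm (grad z - grad x) \<le> L * norm (z - x)"
    using least_squares_grad_lipschitz by blast
  obtain M where M: "0 < M" "\<And>v. v \<in> D \<Longrightarrow> norm v \<le> M" using bounds by metis
  \<comment> \<open>The three terms account for the movement divided by the step size, for the
    gradient taken at an earlier point of the cycle, and for the quotient at the time of the step
    standing in place of \<open>Qs\<close>.\<close>
  define C1 where "C1 = 1 / \<alpha>lo + L + M"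
  define C2 where "C2 = Qs / \<alpha>lo + Qs"
  have C12: "0 \<le> C1" "0 \<le> C2" using \<alpha>lo L M Qs by (auto simp: C1_def C2_def)
  have "\<exists>\<xi> w.
    (\<forall>z\<in>cbox lo hi. l1_norm (x (Suc N * Suc k)) + \<xi> \<bullet> (z - x (Suc N * Suc k)) \<le> l1_norm z) \<and>
    (\<forall>y'\<in>D. w \<bullet> (y' - y (Suc N * Suc k)) \<le> 0) \<and>
    norm (\<xi> + grad (x (Suc N * Suc k)) - Qs *\<^sub>R y (Suc N * Suc k)) + norm (w - Qs *\<^sub>R x (Suc N * Suc k))
      \<le> (CARD('n) * C1 + C2) * (cycle_length k + (Q (Suc N * k) - Qs))" for k
  proof -
    define X Y S p where "X = x (Suc N * Suc k)" and "Y = y (Suc N * Suc k)"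
      and "S = cycle_length k" and "p = Q (Suc N * k) - Qs"
    have Sp: "0 \<le> S" "0 \<le> p" using cycle_length_nonneg Qs by (auto simp: S_def p_def)
    define T where "T = (\<lambda>j. Suc N * k + blk j)"
    have Tmod: "T j mod Suc N = blk j" "blk j \<noteq> 0" for j
      using blk[of j] cycle_mod[of "blk j" k] by (auto simp: T_def)
    have "\<exists>\<alpha>\<ge>\<alpha>lo. \<forall>s\<in>{lo $ j..hi $ j}. \<bar>X $ j\<bar> +
        ((x (T j) - x (Suc (T j))) $ j / \<alpha> - grad (x (T j)) $ j + Q (T j) * Y $ j) * (s - X $ j) \<le> \<bar>s\<bar>" for j
    proof -
      \<comment> \<open>y moves only at offset 0 and blocks are numbered from 1, so every block step
        already sees the final \<open>Y\<close>.\<close>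
      have "y (T j) = Y" using cycle_y[of "blk j" k] blk[of j] by (simp add: T_def Y_def)
      moreover have "X $ j = x (Suc (T j)) $ j" unfolding X_def T_def by (rule cycle_end_x)
      ultimately show ?thesis using x_step_subgrad[of "T j"] Tmod[of j] by auto
    qed
    then obtain \<alpha> where \<alpha>: "\<And>j. \<alpha>lo \<le> \<alpha> j" "\<And>j s. s \<in> {lo $ j..hi $ j} \<Longrightarrow> \<bar>X $ j\<bar> +
        ((x (T j) - x (Suc (T j))) $ j / \<alpha> j - grad (x (T j)) $ j + Q (T j) * Y $ j) * (s - X $ j) \<le> \<bar>s\<bar>"
      by metis
    \<comment> \<open>Each coordinate takes its slope from the time \<open>T j\<close> at which its
      block is updated; by separability the result is a single subgradient at the end of the
      cycle.\<close>
    define \<xi> where "\<xi> = (\<chi> j. (x (T j) - x (Suc (T j))) $ j / \<alpha> j - grad (x (T j)) $ j + Q (T j) * Y $ j)"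
    have sub: "l1_norm X + \<xi> \<bullet> (z - X) \<le> l1_norm z" if "z \<in> cbox lo hi" for z
    proof -
      have "l1_norm X + \<xi> \<bullet> (z - X) = (\<Sum>j\<in>UNIV. \<bar>X $ j\<bar> + \<xi> $ j * (z $ j - X $ j))"
        by (simp add: l1_norm_def inner_vec_def sum.distrib)
      also have "\<dots> \<le> l1_norm z"
        unfolding l1_norm_def using that \<alpha>(2) by (intro sum_mono) (auto simp: \<xi>_def mem_box_cart)
      finally show ?thesis .
    qed
    have comp: "\<bar>(\<xi> + grad X - Qs *\<^sub>R Y) $ j\<bar> \<le> C1 * (S + p)" for j
    proof -
      have "(\<xi> + grad X - Qs *\<^sub>R Y) $ j =
          (x (T j) - x (Suc (T j))) $ j / \<alpha> j + (grad X - grad (x (T j))) $ j + (Q (T j) - Qs) * Y $ j"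
        by (simp add: \<xi>_def algebra_simps)
      moreover have "\<bar>(x (T j) - x (Suc (T j))) $ j / \<alpha> j\<bar> \<le> S / \<alpha>lo"
      proof -
        have "\<bar>(x (T j) - x (Suc (T j))) $ j\<bar> \<le> S"
          using component_le_norm_cart[of "x (Suc (T j)) - x (T j)" j] cycle_step_le(1)[of "blk j" k] blk[of j]
          by (simp add: T_def S_def abs_minus_commute)
        then show ?thesis using \<alpha>(1)[of j] \<alpha>lo Sp by (auto simp: abs_divide intro!: frac_le)
      qed
      moreover have "\<bar>(grad X - grad (x (T j))) $ j\<bar> \<le> L * S"
      proof -
        have "\<bar>(grad X - grad (x (T j))) $ j\<bar> \<le> L * norm (X - x (T j))"
          using component_le_norm_cart L(2) order_trans by blast
        also have "\<dots> \<le> L * S"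
          using cycle_x_diff_le[of "blk j" k] blk[of j] L(1)
          by (intro mult_left_mono) (auto simp: X_def T_def S_def)
        finally show ?thesis .
      qed
      moreover have "\<bar>(Q (T j) - Qs) * Y $ j\<bar> \<le> p * M"
        unfolding abs_mult
      proof (rule mult_mono)
        show "\<bar>Q (T j) - Qs\<bar> \<le> p"
          using Qs(2)[of "T j"] Q_antimono[of "Suc N * k" "T j"] by (simp add: p_def T_def)
        show "\<bar>Y $ j\<bar> \<le> M"
          using component_le_norm_cart[of Y j] M(2)[OF y_in] by (simp add: Y_def order_trans)
      qed (use Sp in auto)
      ultimately have "\<bar>(\<xi> + grad X - Qs *\<^sub>R Y) $ j\<bar> \<le> S / \<alpha>lo + L * S + p * M" by linarith
      also have "\<dots> \<le> C1 * (S + p)"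
        using Sp L(1) M(1) \<alpha>lo
        by (simp add: C1_def add_divide_distrib distrib_left distrib_right mult.commute)
      finally show ?thesis .
    qed
    have n1: "norm (\<xi> + grad X - Qs *\<^sub>R Y) \<le> CARD('n) * C1 * (S + p)"
    proof -
      have "norm (\<xi> + grad X - Qs *\<^sub>R Y) \<le> (\<Sum>j\<in>UNIV. \<bar>(\<xi> + grad X - Qs *\<^sub>R Y) $ j\<bar>)"
        by (rule norm_le_l1_cart)
      also have "\<dots> \<le> of_nat CARD('n) * (C1 * (S + p))" by (rule sum_bounded_above) (rule comp)
      finally show ?thesis by simp
    qed
    define t where "t = Suc N * k"
    have "t mod Suc N = 0" unfolding t_def by (rule mod_mult_self1_is_0)
    moreover have Yt: "y (Suc t) = Y" using cycle_y[of 1 k] by (simp add: t_def Y_def)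
    ultimately obtain \<beta> where \<beta>: "\<alpha>lo \<le> \<beta>" "\<forall>y'\<in>D. (y t + \<beta> *\<^sub>R x t - Y) \<bullet> (y' - Y) \<le> 0"
      using y_step[of t] by auto
    \<comment> \<open>Nonnegative scaling preserves normality. The factor Qs / \<beta> turns the
      part \<beta> x t into Qs x t, which differs from Qs X only by the movement within the
      cycle.\<close>
    define w where "w = (Qs / \<beta>) *\<^sub>R (y t + \<beta> *\<^sub>R x t - Y)"
    have normal: "\<forall>y'\<in>D. w \<bullet> (y' - Y) \<le> 0"
      using \<beta> Qs(1) \<alpha>lo by (auto simp: w_def intro!: divide_nonpos_nonneg mult_nonneg_nonpos)
    have "w - Qs *\<^sub>R X = (Qs / \<beta>) *\<^sub>R (y t - Y) + Qs *\<^sub>R (x t - X)"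
      using \<beta>(1) \<alpha>lo by (simp add: w_def algebra_simps)
    then have "norm (w - Qs *\<^sub>R X) \<le> Qs / \<beta> * norm (y t - Y) + Qs * norm (x t - X)"
      using norm_triangle_ineq[of "(Qs / \<beta>) *\<^sub>R (y t - Y)" "Qs *\<^sub>R (x t - X)"] Qs(1) \<beta>(1) \<alpha>lo by simp
    also have "\<dots> \<le> Qs / \<alpha>lo * S + Qs * S"
    proof (intro add_mono mult_mono)
      show "norm (y t - Y) \<le> S"
        using cycle_step_le(2)[of 0 k] Yt by (simp add: t_def S_def norm_minus_commute)
      show "norm (x t - X) \<le> S"
        using cycle_x_diff_le[of 0 k] by (simp add: t_def S_def X_def norm_minus_commute)
    qed (use \<beta> Qs \<alpha>lo Sp in \<open>auto intro!: divide_left_mono\<close>)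
    also have "\<dots> = C2 * S" by (simp add: C2_def algebra_simps)
    also have "\<dots> \<le> C2 * (S + p)" using C12 Sp by (intro mult_left_mono) auto
    finally have "norm (\<xi> + grad X - Qs *\<^sub>R Y) + norm (w - Qs *\<^sub>R X) \<le> (CARD('n) * C1 + C2) * (S + p)"
      using n1 by (simp add: distrib_right)
    with sub normal show ?thesis unfolding X_def Y_def S_def p_def by blast
  qed
  moreover have "0 \<le> CARD('n) * C1 + C2" using C12 by simp
  ultimately show thesis using that by blast
qed

end

lemma tendsto_0_norm_le:
  fixes f :: "nat \<Rightarrow> 'a::real_normed_vector"
  assumes "g \<longlonglongrightarrow> 0" "\<And>k. norm (f k) \<le> g k"
  shows "f \<longlonglongrightarrow> 0"
  by (rule Lim_null_comparison[OF always_eventually assms(1)]) (simp add: assms(2))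

section \<open>From the error bound to geometric decay and convergence\<close>

context cyclic_descent
begin

text \<open>Cauchy-Schwarz over the N + 1 steps of a cycle, after which the decreases of Q
  telescope.\<close>

lemma cycle_length_power2_le:
  obtains G where "0 \<le> G" "\<And>k. (cycle_length k)\<^sup>2 \<le> G * (Q (Suc N * k) - Q (Suc N * Suc k))"
proof -
  obtain \<kappa> where \<kappa>: "0 < \<kappa>"
    "\<And>t. \<kappa> * ((norm (x (Suc t) - x t))\<^sup>2 + (norm (y (Suc t) - y t))\<^sup>2) \<le> Q t - Q (Suc t)"
    using sufficient_decrease by metis
  define a where "a = (\<lambda>t. norm (x (Suc t) - x t) + norm (y (Suc t) - y t))"
  have a: "(a t)\<^sup>2 \<le> 2 / \<kappa> * (Q t - Q (Suc t))" for t
  proof -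
    define u v where "u = norm (x (Suc t) - x t)" and "v = norm (y (Suc t) - y t)"
    have "(u + v)\<^sup>2 \<le> 2 * (u\<^sup>2 + v\<^sup>2)"
      using sum_power2_ge_zero[of "u - v" 0] by (simp add: power2_eq_square algebra_simps)
    also have "\<dots> \<le> 2 * ((Q t - Q (Suc t)) / \<kappa>)"
      using \<kappa>(2)[of t] \<kappa>(1) by (simp add: u_def[symmetric] v_def[symmetric] field_simps)
    finally show ?thesis by (simp add: a_def u_def v_def)
  qed
  have "(cycle_length k)\<^sup>2 \<le> 2 / \<kappa> * real (Suc N) * (Q (Suc N * k) - Q (Suc N * Suc k))" for k
  proof -
    have "(cycle_length k)\<^sup>2 \<le> (\<Sum>s<Suc N. (a (Suc N * k + s))\<^sup>2) * real (card {..<Suc N})"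
      unfolding cycle_length_def a_def by (rule sum_squared_le_sum_of_squares)
    also have "\<dots> \<le> (\<Sum>s<Suc N. 2 / \<kappa> * (Q (Suc N * k + s) - Q (Suc (Suc N * k + s)))) * real (card {..<Suc N})"
      by (intro mult_right_mono sum_mono a) auto
    also have "(\<Sum>s<Suc N. 2 / \<kappa> * (Q (Suc N * k + s) - Q (Suc (Suc N * k + s)))) =
        2 / \<kappa> * (\<Sum>s<Suc N. Q (Suc N * k + s) - Q (Suc N * k + Suc s))"
      by (simp only: sum_distrib_left add_Suc_right)
    also have "(\<Sum>s<Suc N. Q (Suc N * k + s) - Q (Suc N * k + Suc s)) =
        Q (Suc N * k + 0) - Q (Suc N * k + Suc N)"
      by (rule sum_lessThan_telescope')
    also have "Suc N * k + Suc N = Suc N * Suc k" by simp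
    finally show ?thesis by (simp only: card_lessThan add_0_right mult_ac)
  qed
  moreover have "0 \<le> 2 / \<kappa> * real (Suc N)" using \<kappa>(1) by simp
  ultimately show thesis by (rule that[rotated])
qed

lemma strict_mono_cycle: "strict_mono (\<lambda>k. Suc N * k)"
  by (rule strict_monoI) (simp only: mult_less_cancel1 zero_less_Suc)

lemma Q_cycle_tendsto:
  assumes "Q \<longlonglongrightarrow> Qs"
  shows "(\<lambda>k. Q (Suc N * k)) \<longlonglongrightarrow> Qs"
  using LIMSEQ_subseq_LIMSEQ[OF assms strict_mono_cycle] by (simp only: o_def)

lemma cycle_length_tendsto_0: "cycle_length \<longlonglongrightarrow> 0"
proof -
  obtain G where G: "0 \<le> G" "\<And>k. (cycle_length k)\<^sup>2 \<le> G * (Q (Suc N * k) - Q (Suc N * Suc k))"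
    using cycle_length_power2_le by metis
  obtain Qs where Qs: "Q \<longlonglongrightarrow> Qs" using Q_limit by metis
  note lim = Q_cycle_tendsto[OF Qs]
  have "(\<lambda>k. sqrt (G * (Q (Suc N * k) - Q (Suc N * Suc k)))) \<longlonglongrightarrow> sqrt (G * (Qs - Qs))"
    by (intro tendsto_intros lim LIMSEQ_Suc[OF lim])
  then have "(\<lambda>k. sqrt (G * (Q (Suc N * k) - Q (Suc N * Suc k)))) \<longlonglongrightarrow> 0" by simp
  then show ?thesis
  proof (rule tendsto_0_norm_le)
    show "norm (cycle_length k) \<le> sqrt (G * (Q (Suc N * k) - Q (Suc N * Suc k)))" for k
      using real_le_rsqrt[OF G(2)] cycle_length_nonneg[of k] by (simp only: real_norm_def abs_of_nonneg)
  qed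
qed

text \<open>At the end of a cycle H equals p (Suc k) times \<langle>X, Y\<rangle>, and \<langle>X,
  Y\<rangle> lies between \<mu> and M squared. The upper bound makes H small, as the error bound
  requires; the lower bound converts the resulting estimate of H back into one of p.\<close>

lemma Q_geometric:
  assumes Qs: "0 < Qs" "Q \<longlonglongrightarrow> Qs" "\<And>t. Qs \<le> Q t"
  obtains B \<rho> where "0 < \<rho>" "\<rho> < 1" "0 \<le> B" "\<And>k. Q (Suc N * k) - Qs \<le> B * \<rho> ^ k"
proof -
  define p where "p = (\<lambda>k. Q (Suc N * k) - Qs)"
  have p0: "0 \<le> p k" for k using Qs(3) by (simp add: p_def)
  have plim: "p \<longlonglongrightarrow> 0"
    using tendsto_diff[OF Q_cycle_tendsto[OF Qs(2)] tendsto_const[of Qs]] by (simp add: p_def)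
  have pdec: "p (Suc k) \<le> p k" for k
    unfolding p_def using Q_antimono[of "Suc N * k" "Suc N * Suc k"] by simp
  obtain G where G: "0 \<le> G" "\<And>k. (cycle_length k)\<^sup>2 \<le> G * (Q (Suc N * k) - Q (Suc N * Suc k))"
    using cycle_length_power2_le by metis
  obtain \<mu> where \<mu>: "0 < \<mu>" "\<And>t. \<mu> \<le> x t \<bullet> y t" using inner_lower_bound by metis
  obtain M where M: "\<And>z v. z \<in> cbox lo hi \<Longrightarrow> v \<in> D \<Longrightarrow> z \<bullet> v \<le> M\<^sup>2" using bounds by metis
  obtain C where C: "0 \<le> C" "\<And>k. \<exists>\<xi> w.
    (\<forall>z\<in>cbox lo hi. l1_norm (x (Suc N * Suc k)) + \<xi> \<bullet> (z - x (Suc N * Suc k)) \<le> l1_norm z) \<and>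
    (\<forall>y'\<in>D. w \<bullet> (y' - y (Suc N * Suc k)) \<le> 0) \<and>
    norm (\<xi> + grad (x (Suc N * Suc k)) - Qs *\<^sub>R y (Suc N * Suc k)) + norm (w - Qs *\<^sub>R x (Suc N * Suc k))
      \<le> C * (cycle_length k + (Q (Suc N * k) - Qs))"
    using cycle_residual[of Qs] Qs by (metis less_imp_le)
  obtain E e where E: "0 \<le> E" "0 < e" "\<forall>x\<in>cbox lo hi. \<forall>y\<in>D. \<forall>\<xi> w.
     (\<forall>z\<in>cbox lo hi. l1_norm x + \<xi> \<bullet> (z - x) \<le> l1_norm z) \<longrightarrow>
     (\<forall>y'\<in>D. w \<bullet> (y' - y) \<le> 0) \<longrightarrow>
     norm (\<xi> + grad x - Qs *\<^sub>R y) + norm (w - Qs *\<^sub>R x) < e \<longrightarrow>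
     \<bar>l1_norm x + least_squares lam A b x - Qs * (x \<bullet> y)\<bar> < e \<longrightarrow>
     l1_norm x + least_squares lam A b x - Qs * (x \<bullet> y) \<le>
       E * (norm (\<xi> + grad x - Qs *\<^sub>R y) + norm (w - Qs *\<^sub>R x))\<^sup>2"
    using l1_least_squares_error_bound[OF D, of lo hi lam A b Qs] by metis
  have "(\<lambda>k. C * (cycle_length k + p k)) \<longlonglongrightarrow> C * (0 + 0)"
    by (intro tendsto_intros cycle_length_tendsto_0 plim)
  moreover have "(\<lambda>k. p (Suc k) * M\<^sup>2) \<longlonglongrightarrow> 0 * M\<^sup>2"
    by (intro tendsto_intros LIMSEQ_Suc[OF plim])
  ultimately have "\<forall>\<^sub>F k in sequentially. C * (cycle_length k + p k) < e \<and> p (Suc k) * M\<^sup>2 < e"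
    using E(2) by (intro eventually_conj order_tendstoD(2)) auto
  then obtain k0 where k0: "\<And>k. k \<ge> k0 \<Longrightarrow> C * (cycle_length k + p k) < e"
    "\<And>k. k \<ge> k0 \<Longrightarrow> p (Suc k) * M\<^sup>2 < e"
    unfolding eventually_sequentially by blast
  \<comment> \<open>The factor 2 splits the square of a sum, C comes from the residual, and \<mu>
    from dividing out \<langle>X, Y\<rangle>. G + 1 dominates both G, from the squared cycle length,
    and 1, from the squared gap.\<close>
  define F where "F = 2 * E * C\<^sup>2 * (G + 1) / \<mu>"
  have F0: "0 \<le> F" using E G \<mu> by (simp add: F_def)
  have rec: "p (Suc k) \<le> F * (p k - p (Suc k)) + F * (p k)\<^sup>2" if k: "k \<ge> k0" for k
  proof -
    define X Y where "X = x (Suc N * Suc k)" and "Y = y (Suc N * Suc k)"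
    have XY: "X \<in> cbox lo hi" "Y \<in> D" using x_in y_in by (auto simp: X_def Y_def)
    obtain \<xi> w where res: "\<forall>z\<in>cbox lo hi. l1_norm X + \<xi> \<bullet> (z - X) \<le> l1_norm z"
      "\<forall>y'\<in>D. w \<bullet> (y' - Y) \<le> 0"
      "norm (\<xi> + grad X - Qs *\<^sub>R Y) + norm (w - Qs *\<^sub>R X) \<le> C * (cycle_length k + p k)"
      using C(2)[of k] by (auto simp only: X_def Y_def p_def)
    \<comment> \<open>By the definition of Q the numerator is Q \<langle>X, Y\<rangle>, so
      subtracting Qs \<langle>X, Y\<rangle> leaves the gap.\<close>
    have H: "l1_norm X + least_squares lam A b X - Qs * (X \<bullet> Y) = p (Suc k) * (X \<bullet> Y)"
      using zeta_eq[of "Suc N * Suc k"]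
      by (simp only: l1_least_squares_def X_def Y_def p_def left_diff_distrib)
    have lb: "\<mu> \<le> X \<bullet> Y" unfolding X_def Y_def by (rule \<mu>(2))
    have "\<bar>p (Suc k) * (X \<bullet> Y)\<bar> \<le> p (Suc k) * M\<^sup>2"
      using M[OF XY] lb \<mu>(1) p0[of "Suc k"] by (simp add: abs_mult mult_left_mono)
    then have "\<bar>p (Suc k) * (X \<bullet> Y)\<bar> < e" using k0(2)[OF k] by linarith
    moreover have "norm (\<xi> + grad X - Qs *\<^sub>R Y) + norm (w - Qs *\<^sub>R X) < e"
      using res(3) k0(1)[OF k] by linarith
    ultimately have "p (Suc k) * (X \<bullet> Y) \<le> E * (norm (\<xi> + grad X - Qs *\<^sub>R Y) + norm (w - Qs *\<^sub>R X))\<^sup>2"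
      using E(3)[rule_format, OF XY res(1)[rule_format] res(2)[rule_format]] unfolding H by blast
    also have "\<dots> \<le> E * (C * (cycle_length k + p k))\<^sup>2"
      using res(3) E(1) by (intro mult_left_mono power_mono) auto
    also have "\<dots> \<le> E * (C\<^sup>2 * (2 * ((cycle_length k)\<^sup>2 + (p k)\<^sup>2)))"
    proof -
      have "(cycle_length k + p k)\<^sup>2 \<le> 2 * ((cycle_length k)\<^sup>2 + (p k)\<^sup>2)"
        using sum_power2_ge_zero[of "cycle_length k - p k" 0] by (simp add: power2_eq_square algebra_simps)
      then show ?thesis using E(1) unfolding power_mult_distrib by (intro mult_left_mono) auto
    qed
    also have "\<dots> \<le> E * (C\<^sup>2 * (2 * ((G + 1) * (p k - p (Suc k)) + (G + 1) * (p k)\<^sup>2)))"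
    proof -
      have "(cycle_length k)\<^sup>2 \<le> G * (p k - p (Suc k))"
        using G(2)[of k] by (simp only: p_def diff_diff_eq2 diff_add_cancel)
      also have "\<dots> \<le> (G + 1) * (p k - p (Suc k))" using pdec[of k] by (intro mult_right_mono) auto
      moreover have "1 * (p k)\<^sup>2 \<le> (G + 1) * (p k)\<^sup>2" using G(1) by (intro mult_right_mono) auto
      ultimately have "(cycle_length k)\<^sup>2 + (p k)\<^sup>2 \<le> (G + 1) * (p k - p (Suc k)) + (G + 1) * (p k)\<^sup>2"
        by linarith
      then show ?thesis using E(1) by (intro mult_left_mono) auto
    qed
    also have "\<dots> = \<mu> * (F * (p k - p (Suc k)) + F * (p k)\<^sup>2)"
    proof -
      have "\<mu> * F = 2 * E * C\<^sup>2 * (G + 1)" using \<mu>(1) by (simp add: F_def)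
      then have "\<mu> * (F * u + F * v) = E * (C\<^sup>2 * (2 * ((G + 1) * u + (G + 1) * v)))" for u v
        by (simp only: distrib_left flip: mult.assoc) (simp add: algebra_simps)
      then show ?thesis by (rule sym)
    qed
    finally have "p (Suc k) * (X \<bullet> Y) \<le> \<mu> * (F * (p k - p (Suc k)) + F * (p k)\<^sup>2)" .
    moreover have "p (Suc k) * \<mu> \<le> p (Suc k) * (X \<bullet> Y)" using lb p0 by (intro mult_left_mono) auto
    ultimately have "\<mu> * p (Suc k) \<le> \<mu> * (F * (p k - p (Suc k)) + F * (p k)\<^sup>2)"
      by (simp only: mult.commute[of \<mu> "p (Suc k)"])
    then show ?thesis using \<mu>(1) by (simp only: mult_le_cancel_left_pos)
  qed
  from quadratic_recursion_geometric[OF plim p0 F0 rec] show thesis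
    using that unfolding p_def by blast
qed

text \<open>A squared step is at most a multiple of the gap of Q at the start of the current cycle.
  Hence the rate per step is the root of the cycle rate, and a further square root passes from
  squared steps to steps.\<close>

lemma steps_geometric:
  obtains B \<theta> where "0 < \<theta>" "\<theta> < 1" "\<And>t. norm (x (Suc t) - x t) \<le> B * \<theta> ^ t"
    "\<And>t. norm (y (Suc t) - y t) \<le> B * \<theta> ^ t"
proof -
  obtain \<kappa> where \<kappa>: "0 < \<kappa>"
    "\<And>t. \<kappa> * ((norm (x (Suc t) - x t))\<^sup>2 + (norm (y (Suc t) - y t))\<^sup>2) \<le> Q t - Q (Suc t)"
    using sufficient_decrease by metis
  obtain Qs where Qs: "0 < Qs" "Q \<longlonglongrightarrow> Qs" "\<And>t. Qs \<le> Q t" using Q_limit by metis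
  obtain B \<rho> where B: "0 < \<rho>" "\<rho> < 1" "0 \<le> B" "\<And>k. Q (Suc N * k) - Qs \<le> B * \<rho> ^ k"
    using Q_geometric[OF Qs] by metis
  define \<tau> where "\<tau> = root (Suc N) \<rho>"
  have \<tau>: "0 < \<tau>" "\<tau> < 1" using B by (auto simp: \<tau>_def)
  have le: "(norm (x (Suc t) - x t))\<^sup>2 + (norm (y (Suc t) - y t))\<^sup>2 \<le> B / (\<rho> * \<kappa>) * \<tau> ^ t" for t
  proof -
    have "Q t \<le> Q (Suc N * (t div Suc N))" by (rule Q_antimono) (rule times_div_less_eq_dividend)
    then have "\<kappa> * ((norm (x (Suc t) - x t))\<^sup>2 + (norm (y (Suc t) - y t))\<^sup>2) \<le> B * \<rho> ^ (t div Suc N)"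
      using \<kappa>(2)[of t] Qs(3)[of "Suc t"] B(4)[of "t div Suc N"] by linarith
    also have "\<dots> \<le> B * (\<tau> ^ t / \<rho>)"
      unfolding \<tau>_def using B by (intro mult_left_mono power_div_le_root_power) auto
    finally show ?thesis using \<kappa>(1) B(1) by (simp add: field_simps)
  qed
  have sqrt: "u \<le> sqrt (B / (\<rho> * \<kappa>)) * sqrt \<tau> ^ t" if "u\<^sup>2 \<le> B / (\<rho> * \<kappa>) * \<tau> ^ t" for u t
    using real_le_rsqrt[OF that] by (simp only: real_sqrt_mult real_sqrt_power)
  show thesis
  proof (rule that)
    show "0 < sqrt \<tau>" "sqrt \<tau> < 1" using \<tau> by auto
    show "norm (x (Suc t) - x t) \<le> sqrt (B / (\<rho> * \<kappa>)) * sqrt \<tau> ^ t" for t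
      by (rule sqrt, rule order_trans[OF _ le[of t]]) simp
    show "norm (y (Suc t) - y t) \<le> sqrt (B / (\<rho> * \<kappa>)) * sqrt \<tau> ^ t" for t
      by (rule sqrt, rule order_trans[OF _ le[of t]]) simp
  qed
qed

text \<open>Geometric steps give limits of x and y. The residuals at the cycle ends tend to 0, so
  \<xi> and w converge, and both variational inequalities pass to the limit. Dividing the second by
  Qs > 0 shows that \<open>ys\<close> maximizes the product with \<open>xs\<close> over
  \<open>D\<close>.\<close>

lemma linear_convergence:
  obtains xs ys B \<theta> Qs where "0 < \<theta>" "\<theta> < 1" "\<And>t. norm (x t - xs) \<le> B * \<theta> ^ t"
    "xs \<in> cbox lo hi" "ys \<in> D" "0 < xs \<bullet> ys" "\<zeta> xs = Qs * (xs \<bullet> ys)"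
    "\<And>y'. y' \<in> D \<Longrightarrow> xs \<bullet> y' \<le> xs \<bullet> ys"
    "\<And>z. z \<in> cbox lo hi \<Longrightarrow> l1_norm xs + (Qs *\<^sub>R ys - grad xs) \<bullet> (z - xs) \<le> l1_norm z"
proof -
  obtain B \<theta> where B: "0 < \<theta>" "\<theta> < 1" "\<And>t. norm (x (Suc t) - x t) \<le> B * \<theta> ^ t"
    "\<And>t. norm (y (Suc t) - y t) \<le> B * \<theta> ^ t"
    using steps_geometric by metis
  obtain xs where xs: "x \<longlonglongrightarrow> xs" "\<And>t. norm (x t - xs) \<le> B / (1 - \<theta>) * \<theta> ^ t"
    using geometric_steps_converge[OF B(1,2,3)] by metis
  obtain ys where ys: "y \<longlonglongrightarrow> ys"
    using geometric_steps_converge[OF B(1,2,4)] by metis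
  obtain Qs where Qs: "0 < Qs" "Q \<longlonglongrightarrow> Qs" "\<And>t. Qs \<le> Q t" using Q_limit by metis
  obtain \<mu> where \<mu>: "0 < \<mu>" "\<And>t. \<mu> \<le> x t \<bullet> y t" using inner_lower_bound by metis
  have xs_in: "xs \<in> cbox lo hi"
    by (rule closed_sequentially[OF closed_cbox _ xs(1)]) (rule x_in)
  have ys_in: "ys \<in> D"
    using closed_sequentially[OF polytope_imp_closed[OF D] _ ys] y_in by blast
  have inner_lim: "(\<lambda>t. x t \<bullet> y t) \<longlonglongrightarrow> xs \<bullet> ys" by (intro tendsto_intros xs ys)
  have "\<mu> \<le> xs \<bullet> ys" by (rule LIMSEQ_le_const[OF inner_lim]) (use \<mu>(2) in auto)
  then have pos: "0 < xs \<bullet> ys" using \<mu>(1) by simp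
  have "(\<lambda>t. \<zeta> (x t)) \<longlonglongrightarrow> \<zeta> xs"
    using continuous_on_tendsto_compose[OF continuous_on_l1_least_squares[of UNIV] xs(1)] by simp
  moreover have "(\<lambda>t. Q t * (x t \<bullet> y t)) \<longlonglongrightarrow> Qs * (xs \<bullet> ys)" by (intro tendsto_mult Qs inner_lim)
  ultimately have zeta_lim: "\<zeta> xs = Qs * (xs \<bullet> ys)"
    using LIMSEQ_unique by (simp add: zeta_eq)
  obtain C where C: "0 \<le> C" "\<And>k. \<exists>\<xi> w.
    (\<forall>z\<in>cbox lo hi. l1_norm (x (Suc N * Suc k)) + \<xi> \<bullet> (z - x (Suc N * Suc k)) \<le> l1_norm z) \<and>
    (\<forall>y'\<in>D. w \<bullet> (y' - y (Suc N * Suc k)) \<le> 0) \<and>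
    norm (\<xi> + grad (x (Suc N * Suc k)) - Qs *\<^sub>R y (Suc N * Suc k)) + norm (w - Qs *\<^sub>R x (Suc N * Suc k))
      \<le> C * (cycle_length k + (Q (Suc N * k) - Qs))"
    using cycle_residual[of Qs] Qs by (metis less_imp_le)
  define X Y where "X = (\<lambda>k. x (Suc N * Suc k))" and "Y = (\<lambda>k. y (Suc N * Suc k))"
  obtain \<xi> w where res: "\<And>k z. z \<in> cbox lo hi \<Longrightarrow> l1_norm (X k) + \<xi> k \<bullet> (z - X k) \<le> l1_norm z"
    "\<And>k y'. y' \<in> D \<Longrightarrow> w k \<bullet> (y' - Y k) \<le> 0"
    "\<And>k. norm (\<xi> k + grad (X k) - Qs *\<^sub>R Y k) + norm (w k - Qs *\<^sub>R X k)
      \<le> C * (cycle_length k + (Q (Suc N * k) - Qs))"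
    using C(2) unfolding X_def Y_def by metis
  have XY: "X \<longlonglongrightarrow> xs" "Y \<longlonglongrightarrow> ys"
    using LIMSEQ_Suc[OF LIMSEQ_subseq_LIMSEQ[OF xs(1) strict_mono_cycle]]
      LIMSEQ_Suc[OF LIMSEQ_subseq_LIMSEQ[OF ys strict_mono_cycle]]
    by (simp_all only: X_def Y_def o_def)
  have "(\<lambda>k. C * (cycle_length k + (Q (Suc N * k) - Qs))) \<longlonglongrightarrow> C * (0 + (Qs - Qs))"
    by (intro tendsto_intros cycle_length_tendsto_0 Q_cycle_tendsto Qs)
  then have bound: "(\<lambda>k. C * (cycle_length k + (Q (Suc N * k) - Qs))) \<longlonglongrightarrow> 0" by simp
  have "norm (\<xi> k + grad (X k) - Qs *\<^sub>R Y k) \<le> C * (cycle_length k + (Q (Suc N * k) - Qs))" for k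
    using res(3)[of k] norm_ge_zero[of "w k - Qs *\<^sub>R X k"] by linarith
  then have r1: "(\<lambda>k. \<xi> k + grad (X k) - Qs *\<^sub>R Y k) \<longlonglongrightarrow> 0"
    by (rule tendsto_0_norm_le[OF bound])
  have "norm (w k - Qs *\<^sub>R X k) \<le> C * (cycle_length k + (Q (Suc N * k) - Qs))" for k
    using res(3)[of k] norm_ge_zero[of "\<xi> k + grad (X k) - Qs *\<^sub>R Y k"] by linarith
  then have r2: "(\<lambda>k. w k - Qs *\<^sub>R X k) \<longlonglongrightarrow> 0"
    by (rule tendsto_0_norm_le[OF bound])
  have grad_lim: "(\<lambda>k. grad (X k)) \<longlonglongrightarrow> grad xs"
  proof -
    obtain L where L: "\<And>z x. norm (grad z - grad x) \<le> L * norm (z - x)"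
      using least_squares_grad_lipschitz by blast
    have "(\<lambda>k. L * norm (X k - xs)) \<longlonglongrightarrow> L * norm (xs - xs)" by (intro tendsto_intros XY)
    then have "(\<lambda>k. L * norm (X k - xs)) \<longlonglongrightarrow> 0" by simp
    then have "(\<lambda>k. grad (X k) - grad xs) \<longlonglongrightarrow> 0" using L by (rule tendsto_0_norm_le)
    then show ?thesis by (simp only: LIM_zero_iff)
  qed
  have "(\<lambda>k. (\<xi> k + grad (X k) - Qs *\<^sub>R Y k) + Qs *\<^sub>R Y k - grad (X k)) \<longlonglongrightarrow> 0 + Qs *\<^sub>R ys - grad xs"
    by (intro tendsto_intros r1 XY grad_lim)
  then have \<xi>_lim: "\<xi> \<longlonglongrightarrow> Qs *\<^sub>R ys - grad xs" by simp
  have "(\<lambda>k. (w k - Qs *\<^sub>R X k) + Qs *\<^sub>R X k) \<longlonglongrightarrow> 0 + Qs *\<^sub>R xs"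
    by (intro tendsto_intros r2 XY)
  then have w_lim: "w \<longlonglongrightarrow> Qs *\<^sub>R xs" by simp
  have "l1_norm xs + (Qs *\<^sub>R ys - grad xs) \<bullet> (z - xs) \<le> l1_norm z" if "z \<in> cbox lo hi" for z
  proof (rule LIMSEQ_le_const2)
    have "(\<lambda>k. l1_norm (X k)) \<longlonglongrightarrow> l1_norm xs"
      using continuous_on_tendsto_compose[OF continuous_on_l1_norm[OF continuous_on_id, of UNIV] XY(1)] by simp
    then show "(\<lambda>k. l1_norm (X k) + \<xi> k \<bullet> (z - X k)) \<longlonglongrightarrow> l1_norm xs + (Qs *\<^sub>R ys - grad xs) \<bullet> (z - xs)"
      by (intro tendsto_add tendsto_inner tendsto_diff tendsto_const XY \<xi>_lim)
  qed (use res(1)[OF that] in blast)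
  moreover have "xs \<bullet> y' \<le> xs \<bullet> ys" if "y' \<in> D" for y'
  proof -
    have "(Qs *\<^sub>R xs) \<bullet> (y' - ys) \<le> 0"
    proof (rule LIMSEQ_le_const2)
      show "(\<lambda>k. w k \<bullet> (y' - Y k)) \<longlonglongrightarrow> (Qs *\<^sub>R xs) \<bullet> (y' - ys)"
        by (intro tendsto_inner tendsto_diff tendsto_const XY w_lim)
    qed (use res(2)[OF that] in blast)
    then show ?thesis using Qs(1) by (simp add: inner_diff_right mult_le_0_iff)
  qed
  ultimately show thesis using that[OF B(1,2) xs(2) xs_in ys_in pos zeta_lim] by blast
qed

end

subsection \<open>Steps of the algorithm\<close>

lemma box_l1_block:
  "box_l1 blk lo hi i (block blk i x) =
     (if \<forall>j. blk j = i \<longrightarrow> lo $ j \<le> x $ j \<and> x $ j \<le> hi $ j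
      then ereal (\<Sum>j | blk j = i. \<bar>x $ j\<bar>) else \<infinity>)"
  by (auto simp: box_l1_def block_def intro!: sum.cong)

lemma block_sum_box_l1:
  fixes x :: "real^'n"
  assumes "block_partition blk N"
  shows "block_sum blk N (box_l1 blk lo hi) x = (if x \<in> cbox lo hi then ereal (l1_norm x) else \<infinity>)"
proof (cases "x \<in> cbox lo hi")
  case True
  then have "block_sum blk N (box_l1 blk lo hi) x = ereal (\<Sum>i=1..N. \<Sum>j | blk j = i. \<bar>x $ j\<bar>)"
    by (simp add: block_sum_def box_l1_block mem_box_cart)
  also have "(\<Sum>i=1..N. \<Sum>j | blk j = i. \<bar>x $ j\<bar>) = l1_norm x"
    using sum.image_gen[of UNIV "\<lambda>j. \<bar>x $ j\<bar>" blk] assms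
    by (simp add: l1_norm_def block_partition_def)
  finally show ?thesis using True by simp
next
  case False
  then obtain j where j: "\<not> (lo $ j \<le> x $ j \<and> x $ j \<le> hi $ j)" by (auto simp: mem_box_cart)
  have "blk j \<in> {1..N}" using assms by (auto simp: block_partition_def)
  moreover have "box_l1 blk lo hi (blk j) (block blk (blk j) x) = \<infinity>" using j by (auto simp: box_l1_block)
  ultimately have "block_sum blk N (box_l1 blk lo hi) x = \<infinity>"
    unfolding block_sum_def by (subst sum_Pinfty) auto
  with False show ?thesis by simp
qed

lemma eff_dom_block_sum_box_l1:
  assumes "block_partition blk N"
  shows "eff_dom (block_sum blk N (box_l1 blk lo hi)) = cbox lo hi"
  by (auto simp: eff_dom_def block_sum_box_l1[OF assms] split: if_splits)

lemma zeta_block_sum_box_l1: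
  assumes "block_partition blk N" "x \<in> cbox lo hi"
  shows "zeta (block_sum blk N (box_l1 blk lo hi)) (least_squares lam A b) x = ereal (l1_least_squares lam A b x)"
  using assms by (simp add: zeta_def block_sum_box_l1 l1_least_squares_def)

lemma frac_F_eq:
  fixes x :: "real^'n"
  assumes "block_partition blk N" "x \<in> cbox lo hi" "K_norm K x \<noteq> 0"
  shows "frac_F (block_sum blk N (box_l1 blk lo hi)) (least_squares lam A b) (K_norm K) x =
    ereal (l1_least_squares lam A b x / K_norm K x)"
  using assms by (simp add: frac_F_def eff_dom_block_sum_box_l1 zeta_block_sum_box_l1)

lemma frac_Q_eq:
  fixes x y :: "real^'n"
  assumes "block_partition blk N" "1 \<le> K" "K \<le> CARD('n)"
    and "x \<in> cbox lo hi" "y \<in> dual_ball K" "0 < x \<bullet> y"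
  shows "frac_Q (block_sum blk N (box_l1 blk lo hi)) (least_squares lam A b) (K_norm K) x y =
    ereal (l1_least_squares lam A b x / (x \<bullet> y))"
  using assms
  by (simp add: frac_Q_def eff_dom_block_sum_box_l1 zeta_block_sum_box_l1
      eff_dom_fenchel_conj_K_norm eta_K_norm)

lemma accepts_iff:
  fixes x y z :: "real^'n"
  assumes "block_partition blk N" "1 \<le> K" "K \<le> CARD('n)"
    and "x \<in> cbox lo hi" "y \<in> dual_ball K" "0 < x \<bullet> y" "z \<in> cbox lo hi"
  shows "accepts (block_sum blk N (box_l1 blk lo hi)) (least_squares lam A b) (K_norm K) \<sigma> x y z \<longleftrightarrow>
    l1_least_squares lam A b z + \<sigma> / 2 * (norm (z - x))\<^sup>2 \<le> l1_least_squares lam A b x / (x \<bullet> y) * (z \<bullet> y)"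
  using assms
  by (simp add: accepts_def frac_Q_eq zeta_block_sum_box_l1 eta_K_norm)

text \<open>The conjugate is an indicator function, so the proximal step is a projection onto the
  ball. The point \<open>y0\<close> has a finite objective, which forces the minimizer into the
  ball.\<close>

lemma prox_fenchel_conj_K_norm:
  fixes v y :: "real^'n"
  assumes K: "1 \<le> K" "K \<le> CARD('n)" and \<alpha>: "0 < \<alpha>" and ne: "y0 \<in> (dual_ball K :: (real^'n) set)"
    and y: "y \<in> prox UNIV (\<lambda>w. ereal \<alpha> * fenchel_conj (K_norm K) w) v"
  shows "y \<in> dual_ball K" "y' \<in> dual_ball K \<Longrightarrow> (v - y) \<bullet> (y' - y) \<le> 0"
proof -
  have \<phi>: "ereal \<alpha> * fenchel_conj (K_norm K) w = (if w \<in> dual_ball K then 0 else \<infinity>)" for w :: "real^'n"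
    using \<alpha> by (simp add: fenchel_conj_K_norm[OF K])
  have min: "(if y \<in> dual_ball K then 0 else \<infinity>) + ereal (1/2 * (norm (y - v))\<^sup>2)
      \<le> (if w \<in> dual_ball K then 0 else \<infinity>) + ereal (1/2 * (norm (w - v))\<^sup>2)" for w
    using y unfolding prox_def \<phi> by blast
  show yD: "y \<in> dual_ball K" using min[of y0] ne by (auto split: if_splits)
  have "(1/2 * (norm (y - v))\<^sup>2) \<le> (1/2 * (norm (w - v))\<^sup>2)" if "w \<in> dual_ball K" for w
    using min[of w] yD that by simp
  then show "(v - y) \<bullet> (y' - y) \<le> 0" if "y' \<in> dual_ball K"
    using convex_prox_subgradient[of "dual_ball K" "\<lambda>_. 0" y y' v] yD that
    by (simp add: convex_on_def)
qed

section \<open>Block subproblems and backtracking\<close>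

lemma convex_on_weighted_abs_sum:
  fixes S :: "(real^'n) set"
  assumes "convex S" "0 \<le> \<alpha>"
  shows "convex_on S (\<lambda>w. \<alpha> * (\<Sum>j\<in>J. \<bar>w $ j\<bar>))"
proof (rule convex_onI[OF _ assms(1)])
  fix t :: real and u v assume t: "0 < t" "t < 1"
  have "(\<Sum>j\<in>J. \<bar>((1 - t) *\<^sub>R u + t *\<^sub>R v) $ j\<bar>) \<le> (\<Sum>j\<in>J. (1 - t) * \<bar>u $ j\<bar> + t * \<bar>v $ j\<bar>)"
  proof (rule sum_mono)
    fix j
    have "\<bar>(1 - t) * u $ j + t * v $ j\<bar> \<le> \<bar>(1 - t) * u $ j\<bar> + \<bar>t * v $ j\<bar>" by (rule abs_triangle_ineq)
    with t show "\<bar>((1 - t) *\<^sub>R u + t *\<^sub>R v) $ j\<bar> \<le> (1 - t) * \<bar>u $ j\<bar> + t * \<bar>v $ j\<bar>"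
      by (simp add: abs_mult)
  qed
  also have "\<dots> = (1 - t) * (\<Sum>j\<in>J. \<bar>u $ j\<bar>) + t * (\<Sum>j\<in>J. \<bar>v $ j\<bar>)"
    by (simp add: sum.distrib sum_distrib_left)
  finally show "\<alpha> * (\<Sum>j\<in>J. \<bar>((1 - t) *\<^sub>R u + t *\<^sub>R v) $ j\<bar>)
      \<le> (1 - t) * (\<alpha> * (\<Sum>j\<in>J. \<bar>u $ j\<bar>)) + t * (\<alpha> * (\<Sum>j\<in>J. \<bar>v $ j\<bar>))"
    using mult_left_mono[OF _ assms(2)] by (fastforce simp: algebra_simps)
qed

text \<open>The subgradient inequality of the proximal point is tested with vectors that differ from
  it in one coordinate. They stay feasible because the box is a product, and both sides reduce to
  that coordinate.\<close>

lemma prox_box_l1: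
  fixes v w :: "real^'n"
  assumes \<alpha>: "0 < \<alpha>" and u: "u \<in> cbox lo hi"
    and w: "w \<in> prox (block_space blk i) (\<lambda>z. ereal \<alpha> * box_l1 blk lo hi i z) v"
  shows "blk j = i \<Longrightarrow> lo $ j \<le> w $ j \<and> w $ j \<le> hi $ j"
    and "blk j = i \<Longrightarrow> s \<in> {lo $ j..hi $ j} \<Longrightarrow> \<bar>w $ j\<bar> + (v - w) $ j / \<alpha> * (s - w $ j) \<le> \<bar>s\<bar>"
proof -
  define S where "S = {z \<in> block_space blk i. \<forall>j. blk j = i \<longrightarrow> lo $ j \<le> z $ j \<and> z $ j \<le> hi $ j}"
  define \<phi> where "\<phi> = (\<lambda>z::real^'n. \<alpha> * (\<Sum>j | blk j = i. \<bar>z $ j\<bar>))"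
  have \<phi>: "ereal \<alpha> * box_l1 blk lo hi i z = (if z \<in> S then ereal (\<phi> z) else \<infinity>)" if "z \<in> block_space blk i" for z
    using \<alpha> that by (simp add: S_def \<phi>_def box_l1_def)
  have w_in: "w \<in> block_space blk i" using w by (simp add: prox_def)
  have min: "(if w \<in> S then ereal (\<phi> w) else \<infinity>) + ereal (1/2 * (norm (w - v))\<^sup>2)
      \<le> (if z \<in> S then ereal (\<phi> z) else \<infinity>) + ereal (1/2 * (norm (z - v))\<^sup>2)" if "z \<in> block_space blk i" for z
  proof -
    have "ereal \<alpha> * box_l1 blk lo hi i w + ereal (1/2 * (norm (w - v))\<^sup>2)
        \<le> ereal \<alpha> * box_l1 blk lo hi i z + ereal (1/2 * (norm (z - v))\<^sup>2)"
      using w that unfolding prox_def by blast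
    then show ?thesis unfolding \<phi>[OF w_in] \<phi>[OF that] .
  qed
  have "block blk i u \<in> S" using u by (auto simp: S_def block_space_def block_def mem_box_cart)
  then have wS: "w \<in> S" using min[of "block blk i u"] by (auto simp: S_def split: if_splits)
  then show "blk j = i \<Longrightarrow> lo $ j \<le> w $ j \<and> w $ j \<le> hi $ j" by (simp add: S_def)
  have convS: "convex S"
  proof -
    have "l \<le> a * c + e * d \<and> a * c + e * d \<le> h"
      if "l \<le> c \<and> c \<le> h" "l \<le> d \<and> d \<le> h" "0 \<le> a" "0 \<le> e" "a + e = 1" for a c d e l h :: real
      using convex_bound_le[of c h d a e] convex_bound_le[of "- c" "- l" "- d" a e] that by simp
    then show ?thesis unfolding S_def block_space_def convex_def by simp blast
  qed
  have real_min: "\<phi> w + 1/2 * (norm (w - v))\<^sup>2 \<le> \<phi> z + 1/2 * (norm (z - v))\<^sup>2" if "z \<in> S" for z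
    using min[of z] wS that by (simp add: S_def)
  show "\<bar>w $ j\<bar> + (v - w) $ j / \<alpha> * (s - w $ j) \<le> \<bar>s\<bar>" if j: "blk j = i" and s: "s \<in> {lo $ j..hi $ j}"
  proof -
    define w' where "w' = (\<chi> l. if l = j then s else w $ l)"
    have "w' \<in> S" using wS j s by (auto simp: S_def w'_def block_space_def)
    then have *: "\<phi> w + (v - w) \<bullet> (w' - w) \<le> \<phi> w'"
      using convex_on_weighted_abs_sum[OF convS] \<alpha> wS real_min
      by (intro convex_prox_subgradient[of S]) (auto simp: \<phi>_def)
    have "(v - w) \<bullet> (w' - w) = (\<Sum>l\<in>UNIV. if l = j then (v - w) $ j * (s - w $ j) else 0)"
      unfolding inner_vec_def by (rule sum.cong) (auto simp: w'_def)
    then have 1: "(v - w) \<bullet> (w' - w) = (v - w) $ j * (s - w $ j)" by simp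
    have "(\<Sum>l | blk l = i. \<bar>w' $ l\<bar> - \<bar>w $ l\<bar>) = (\<Sum>l | blk l = i. if l = j then \<bar>s\<bar> - \<bar>w $ j\<bar> else 0)"
      by (rule sum.cong) (auto simp: w'_def)
    then have "(\<Sum>l | blk l = i. \<bar>w' $ l\<bar>) - (\<Sum>l | blk l = i. \<bar>w $ l\<bar>) = \<bar>s\<bar> - \<bar>w $ j\<bar>"
      using j by (simp add: sum_subtractf)
    then have "\<phi> w' - \<phi> w = \<alpha> * (\<bar>s\<bar> - \<bar>w $ j\<bar>)"
      by (simp add: \<phi>_def flip: right_diff_distrib)
    with * 1 have "(v - w) $ j * (s - w $ j) \<le> \<alpha> * (\<bar>s\<bar> - \<bar>w $ j\<bar>)" by linarith
    then have "(v - w) $ j * (s - w $ j) / \<alpha> \<le> \<bar>s\<bar> - \<bar>w $ j\<bar>"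
      using \<alpha> by (simp add: pos_divide_le_eq mult.commute)
    then show ?thesis by simp
  qed
qed

lemma trial_points_properties:
  fixes x y :: "real^'n" and A :: "real^'n^'m"
  assumes part: "block_partition blk N" and K: "1 \<le> K" "K \<le> CARD('n)" and \<alpha>: "0 < \<alpha>"
    and x: "x \<in> cbox lo hi" and y: "y \<in> dual_ball K" and xy: "0 < x \<bullet> y"
    and z: "z \<in> trial_points blk N (box_l1 blk lo hi) (least_squares lam A b) (K_norm K) i \<alpha> x y"
  shows "z \<in> cbox lo hi"
    and "blk j \<noteq> i \<Longrightarrow> z $ j = x $ j"
    and "blk j = i \<Longrightarrow> s \<in> {lo $ j..hi $ j} \<Longrightarrow> \<bar>z $ j\<bar> + ((x - z) $ j / \<alpha> - least_squares_grad lam A b x $ j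
           + l1_least_squares lam A b x / (x \<bullet> y) * y $ j) * (s - z $ j) \<le> \<bar>s\<bar>"
proof -
  define q where "q = l1_least_squares lam A b x / (x \<bullet> y)"
  define v where "v = block blk i x - \<alpha> *\<^sub>R block blk i (least_squares_grad lam A b x) + (\<alpha> * q) *\<^sub>R block blk i y"
  obtain w where w: "z = replace_block blk i w x"
    "w \<in> prox (block_space blk i) (\<lambda>z. ereal \<alpha> * box_l1 blk lo hi i z) v"
    using z frac_Q_eq[OF part K x y xy, of lam A b]
    by (auto simp: trial_points_def partial_gradient_def gradient_least_squares v_def q_def)
  note prox = prox_box_l1[OF \<alpha> x w(2)]
  show "blk j \<noteq> i \<Longrightarrow> z $ j = x $ j" by (simp add: w(1) replace_block_def)
  show "z \<in> cbox lo hi" using prox(1) x by (auto simp: w(1) replace_block_def mem_box_cart)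
  assume j: "blk j = i" and s: "s \<in> {lo $ j..hi $ j}"
  have "(v - w) $ j / \<alpha> = (x - z) $ j / \<alpha> - least_squares_grad lam A b x $ j + q * y $ j"
    using j \<alpha> by (simp add: v_def w(1) replace_block_def block_def field_simps)
  then show "\<bar>z $ j\<bar> + ((x - z) $ j / \<alpha> - least_squares_grad lam A b x $ j
           + l1_least_squares lam A b x / (x \<bullet> y) * y $ j) * (s - z $ j) \<le> \<bar>s\<bar>"
    using prox(2)[OF j s] j by (simp add: q_def w(1) replace_block_def)
qed

text \<open>The old point x is inserted into the subgradient inequality of the subproblem. Convexity
  of the l1-norm and the box yields the full coefficient 1 / \<alpha>, of which the quadratic upper
  bound of the least-squares term consumes L / 2; the terms with x on the right cancel because q
  \<langle>x, y\<rangle> is the old numerator.\<close>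

lemma trial_point_descent:
  fixes x y :: "real^'n" and A :: "real^'n^'m"
  assumes part: "block_partition blk N" and K: "1 \<le> K" "K \<le> CARD('n)" and \<alpha>: "0 < \<alpha>"
    and x: "x \<in> cbox lo hi" and y: "y \<in> dual_ball K" and xy: "0 < x \<bullet> y"
    and z: "z \<in> trial_points blk N (box_l1 blk lo hi) (least_squares lam A b) (K_norm K) i \<alpha> x y"
    and L: "\<And>d. lam * (norm (A *v d))\<^sup>2 \<le> L * (norm d)\<^sup>2"
  shows "l1_least_squares lam A b z + (1 / \<alpha> - L / 2) * (norm (z - x))\<^sup>2
    \<le> l1_least_squares lam A b x / (x \<bullet> y) * (z \<bullet> y)"
proof -
  define q where "q = l1_least_squares lam A b x / (x \<bullet> y)"
  define c where "c = (1 / \<alpha>) *\<^sub>R (x - z) - least_squares_grad lam A b x + q *\<^sub>R y"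
  note tp = trial_points_properties[OF part K \<alpha> x y xy z]
  \<comment> \<open>Outside the block z and x agree and both sides coincide; inside it, x $ j is an
    admissible test value.\<close>
  have "\<bar>z $ j\<bar> + c $ j * (x $ j - z $ j) \<le> \<bar>x $ j\<bar>" for j
    using tp(2)[of j] tp(3)[of j "x $ j"] x
    by (cases "blk j = i") (auto simp: c_def q_def mem_box_cart)
  then have "(\<Sum>j\<in>UNIV. \<bar>z $ j\<bar> + c $ j * (x $ j - z $ j)) \<le> l1_norm x"
    unfolding l1_norm_def by (intro sum_mono)
  then have "l1_norm z + c \<bullet> (x - z) \<le> l1_norm x"
    by (simp add: l1_norm_def inner_vec_def sum.distrib)
  moreover have "c \<bullet> (x - z) = (1 / \<alpha>) * (norm (z - x))\<^sup>2
      + least_squares_grad lam A b x \<bullet> (z - x) + q * (x \<bullet> y) - q * (z \<bullet> y)"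
  proof -
    have "c \<bullet> (x - z) = 1 / \<alpha> * (norm (x - z))\<^sup>2 - least_squares_grad lam A b x \<bullet> (x - z) + q * (y \<bullet> (x - z))"
      by (simp only: c_def inner_add_left inner_diff_left inner_scaleR_left power2_norm_eq_inner)
    then show ?thesis
      by (simp add: norm_minus_commute[of z x] inner_diff_right inner_commute[of y] right_diff_distrib)
  qed
  moreover have "q * (x \<bullet> y) = l1_least_squares lam A b x" using xy by (simp add: q_def)
  moreover have "least_squares lam A b z \<le> least_squares lam A b x
      + least_squares_grad lam A b x \<bullet> (z - x) + L / 2 * (norm (z - x))\<^sup>2"
    using least_squares_expand[of lam A b z x] L[of "z - x"] by simp
  ultimately have "l1_least_squares lam A b z + 1 / \<alpha> * (norm (z - x))\<^sup>2 - L / 2 * (norm (z - x))\<^sup>2 \<le> q * (z \<bullet> y)"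
    unfolding l1_least_squares_def by linarith
  then show ?thesis unfolding q_def left_diff_distrib by linarith
qed

text \<open>A step size below 2 / (L + \<sigma>) passes the acceptance test by the preceding descent
  estimate. So the last rejected one is at least this large, and the accepted one is \<gamma> times
  it, unless the initial step size is accepted.\<close>

lemma line_search_step:
  fixes x y :: "real^'n" and A :: "real^'n^'m"
  assumes part: "block_partition blk N" and K: "1 \<le> K" "K \<le> CARD('n)"
    and \<alpha>: "0 < \<alpha>lo" "\<alpha>lo \<le> \<alpha>" and \<sigma>: "0 < \<sigma>" and \<gamma>: "0 < \<gamma>"
    and x: "x \<in> cbox lo hi" and y: "y \<in> dual_ball K" and xy: "0 < x \<bullet> y"
    and L: "0 \<le> L" "\<And>d. lam * (norm (A *v d))\<^sup>2 \<le> L * (norm d)\<^sup>2"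
    and ls: "line_search blk N (box_l1 blk lo hi) (least_squares lam A b) (K_norm K) \<sigma> \<gamma> i \<alpha> x y x'"
  obtains \<beta> where "min \<alpha>lo (2 * \<gamma> / (L + \<sigma>)) \<le> \<beta>"
    "x' \<in> trial_points blk N (box_l1 blk lo hi) (least_squares lam A b) (K_norm K) i \<beta> x y"
    "l1_least_squares lam A b x' + \<sigma> / 2 * (norm (x' - x))\<^sup>2 \<le> l1_least_squares lam A b x / (x \<bullet> y) * (x' \<bullet> y)"
proof -
  obtain k p where p: "\<And>l. l \<le> k \<Longrightarrow>
      p l \<in> trial_points blk N (box_l1 blk lo hi) (least_squares lam A b) (K_norm K) i (\<alpha> * \<gamma> ^ l) x y"
    "\<And>l. l < k \<Longrightarrow> \<not> accepts (block_sum blk N (box_l1 blk lo hi)) (least_squares lam A b) (K_norm K) \<sigma> x y (p l)"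
    "accepts (block_sum blk N (box_l1 blk lo hi)) (least_squares lam A b) (K_norm K) \<sigma> x y (p k)"
    "x' = p k"
    using ls unfolding line_search_def by blast
  have pos: "0 < \<alpha> * \<gamma> ^ l" for l using \<alpha> \<gamma> by simp
  have box: "p l \<in> cbox lo hi" if "l \<le> k" for l
    by (rule trial_points_properties(1)[OF part K pos x y xy p(1)[OF that]])
  have "min \<alpha>lo (2 * \<gamma> / (L + \<sigma>)) \<le> \<alpha> * \<gamma> ^ k"
  proof (cases k)
    case 0
    then show ?thesis using \<alpha> by simp
  next
    case (Suc l)
    define \<delta> where "\<delta> = \<alpha> * \<gamma> ^ l"
    have \<delta>: "0 < \<delta>" unfolding \<delta>_def by (rule pos)
    have "2 / (L + \<sigma>) \<le> \<delta>"
    proof (rule ccontr)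
      assume "\<not> ?thesis"
      then have "\<delta> * (L + \<sigma>) < 2" using L(1) \<sigma> by (simp add: field_simps)
      then have "\<sigma> / 2 \<le> 1 / \<delta> - L / 2" using \<delta> by (simp add: field_simps)
      then have "\<sigma> / 2 * (norm (p l - x))\<^sup>2 \<le> (1 / \<delta> - L / 2) * (norm (p l - x))\<^sup>2"
        by (rule mult_right_mono) simp
      moreover have "p l \<in> trial_points blk N (box_l1 blk lo hi) (least_squares lam A b) (K_norm K) i \<delta> x y"
        using p(1)[of l] Suc by (simp add: \<delta>_def)
      note trial_point_descent[OF part K \<delta> x y xy this L(2)]
      ultimately have "l1_least_squares lam A b (p l) + \<sigma> / 2 * (norm (p l - x))\<^sup>2
          \<le> l1_least_squares lam A b x / (x \<bullet> y) * (p l \<bullet> y)"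
        by linarith
      then show False
        using p(2)[of l] accepts_iff[OF part K x y xy box[of l], where lam = lam and A = A and b = b and \<sigma> = \<sigma>] Suc by simp
    qed
    then have "2 / (L + \<sigma>) * \<gamma> \<le> \<delta> * \<gamma>" using \<gamma> by (intro mult_right_mono) auto
    then show ?thesis by (simp add: Suc \<delta>_def mult_ac)
  qed
  moreover have "l1_least_squares lam A b x' + \<sigma> / 2 * (norm (x' - x))\<^sup>2
      \<le> l1_least_squares lam A b x / (x \<bullet> y) * (x' \<bullet> y)"
    using p(3,4) accepts_iff[OF part K x y xy box[of k], where lam = lam and A = A and b = b and \<sigma> = \<sigma>] by simp
  ultimately show thesis using p(1)[of k] p(4) by (intro that) auto
qed

section \<open>Criticality of the limit and conclusion\<close>

lemma subgradient_in_frechet_subdiff: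
  fixes x :: "'a::real_inner"
  assumes f: "\<And>z. f z = (if z \<in> S then ereal (\<phi> z) else \<infinity>)" and "x \<in> S"
    and sub: "\<And>z. z \<in> S \<Longrightarrow> \<phi> x + u \<bullet> (z - x) \<le> \<phi> z"
  shows "u \<in> frechet_subdiff f x"
proof -
  have "0 \<le> (f z - f x - ereal (u \<bullet> (z - x))) / ereal (norm (z - x))" if "z \<noteq> x" for z
  proof (cases "z \<in> S")
    case True
    then show ?thesis using sub[OF True] \<open>x \<in> S\<close> that by (simp add: f zero_ereal_def)
  next
    case False
    then show ?thesis using \<open>x \<in> S\<close> that by (simp add: f)
  qed
  then have "\<forall>\<^sub>F z in at x. 0 \<le> (f z - f x - ereal (u \<bullet> (z - x))) / ereal (norm (z - x))"
    by (simp add: eventually_at_filter)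
  then show ?thesis unfolding frechet_subdiff_def by (simp add: Liminf_bounded)
qed

theorem theorem6p12:
  fixes A :: "real^'n^'m" and b :: "real^'m" and xlo xhi :: "real^'n"
    and lam \<alpha>lo \<alpha>hi \<sigma> \<gamma> :: real and K N :: nat and blk :: "'n \<Rightarrow> nat"
    and x y :: "nat \<Rightarrow> real^'n"
  assumes "b \<noteq> 0" and "lam > 0" and "1 \<le> K" and "K \<le> CARD('n)"
    and "block_partition blk N"
    and "0 < \<alpha>lo" and "\<alpha>lo \<le> \<alpha>hi" and "\<sigma> > 0" and "0 < \<gamma>" and "\<gamma> < 1"
    and "CMPGA_ML blk N (box_l1 blk xlo xhi) (least_squares lam A b) (K_norm K)
           \<alpha>lo \<alpha>hi \<sigma> \<gamma> x y"
  shows "\<exists>xs. critical_point (block_sum blk N (box_l1 blk xlo xhi)) (least_squares lam A b)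
                 (K_norm K) xs
              \<and> R_linearly_converges x xs"
proof -
  note part = assms(5) and K = assms(3,4)
  have run: "x 0 \<in> eff_dom (frac_F (block_sum blk N (box_l1 blk xlo xhi)) (least_squares lam A b) (K_norm K))"
    "y 0 \<in> convex_subdiff (K_norm K) (x 0)"
    "\<And>t. \<exists>\<alpha>\<in>{\<alpha>lo..\<alpha>hi}. if t mod Suc N = 0
        then x (Suc t) = x t \<and>
          y (Suc t) \<in> prox UNIV (\<lambda>w. ereal \<alpha> * fenchel_conj (K_norm K) w) (y t + \<alpha> *\<^sub>R x t)
        else line_search blk N (box_l1 blk xlo xhi) (least_squares lam A b) (K_norm K) \<sigma> \<gamma>
          (t mod Suc N) \<alpha> (x t) (y t) (x (Suc t)) \<and> y (Suc t) = y t"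
    using assms(11) unfolding CMPGA_ML_def by (simp_all add: Let_def)
  obtain B where B: "0 \<le> B" "\<And>d. norm (A *v d) \<le> norm d * B"
    using bounded_linear.nonneg_bounded[OF matrix_vector_mul_bounded_linear[of A]] by blast
  define L where "L = lam * B\<^sup>2"
  have L: "0 \<le> L" "lam * (norm (A *v d))\<^sup>2 \<le> L * (norm d)\<^sup>2" for d
  proof -
    show "0 \<le> L" using assms(2) by (simp add: L_def)
    have "(norm (A *v d))\<^sup>2 \<le> (norm d * B)\<^sup>2" by (intro power_mono B) simp
    then show "lam * (norm (A *v d))\<^sup>2 \<le> L * (norm d)\<^sup>2"
      using assms(2) by (simp add: L_def power_mult_distrib mult_ac)
  qed
  let ?D = "dual_ball K :: (real^'n) set"
  let ?zeta = "l1_least_squares lam A b"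
  define Q where "Q = (\<lambda>t. ?zeta (x t) / (x t \<bullet> y t))"
  \<comment> \<open>A common lower bound for the step sizes of y-steps and for those accepted by the
    line search.\<close>
  define \<alpha>min where "\<alpha>min = min \<alpha>lo (2 * \<gamma> / (L + \<sigma>))"
  have \<alpha>min: "0 < \<alpha>min" using assms(6,8,9) L(1) by (simp add: \<alpha>min_def)
  have y_step: "x (Suc t) = x t \<and> y (Suc t) \<in> ?D \<and> (\<exists>\<alpha>\<in>{\<alpha>min..\<alpha>hi}. \<forall>y'\<in>?D.
      (y t + \<alpha> *\<^sub>R x t - y (Suc t)) \<bullet> (y' - y (Suc t)) \<le> 0)"
    if t: "t mod Suc N = 0" and yt: "y t \<in> ?D" for t
  proof -
    obtain \<alpha> where \<alpha>: "\<alpha>lo \<le> \<alpha>" "\<alpha> \<le> \<alpha>hi" "x (Suc t) = x t"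
      "y (Suc t) \<in> prox UNIV (\<lambda>w. ereal \<alpha> * fenchel_conj (K_norm K) w) (y t + \<alpha> *\<^sub>R x t)"
      using run(3)[of t] t by auto
    have "0 < \<alpha>" using \<alpha>(1) assms(6) by simp
    note prox = prox_fenchel_conj_K_norm[OF K this yt \<alpha>(4)]
    have "\<alpha> \<in> {\<alpha>min..\<alpha>hi}" using \<alpha>(1,2) by (simp add: \<alpha>min_def)
    with \<alpha>(3) prox show ?thesis by blast
  qed
  have x_step: "\<exists>\<beta>\<ge>\<alpha>min. y (Suc t) = y t \<and>
      x (Suc t) \<in> trial_points blk N (box_l1 blk xlo xhi) (least_squares lam A b) (K_norm K) (t mod Suc N) \<beta> (x t) (y t) \<and>
      ?zeta (x (Suc t)) + \<sigma> / 2 * (norm (x (Suc t) - x t))\<^sup>2 \<le> Q t * (x (Suc t) \<bullet> y t)"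
    if t: "t mod Suc N \<noteq> 0" and inv: "x t \<in> cbox xlo xhi" "y t \<in> ?D" "0 < x t \<bullet> y t" for t
  proof -
    obtain \<alpha> where \<alpha>: "\<alpha>lo \<le> \<alpha>" "y (Suc t) = y t"
      "line_search blk N (box_l1 blk xlo xhi) (least_squares lam A b) (K_norm K) \<sigma> \<gamma>
          (t mod Suc N) \<alpha> (x t) (y t) (x (Suc t))"
      using run(3)[of t] t by auto
    from line_search_step[OF part K assms(6) \<alpha>(1) assms(8,9) inv L \<alpha>(3)]
    show ?thesis using \<alpha>(2) unfolding \<alpha>min_def Q_def by metis
  qed
  \<comment> \<open>The product starts as the nonzero K-norm of x 0. A y-step does not lower it, by
    the projection inequality; after an x-step it is positive because the accepted inequality bounds
    Q times it below by a positive number and Q > 0.\<close>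
  have inv: "x t \<in> cbox xlo xhi \<and> y t \<in> ?D \<and> 0 < x t \<bullet> y t" for t
  proof (induction t)
    case 0
    have "x 0 \<in> cbox xlo xhi" "K_norm K (x 0) \<noteq> 0"
      using run(1) by (auto simp: eff_dom_def[of "frac_F _ _ _"] frac_F_def
          eff_dom_block_sum_box_l1[OF part] split: if_splits)
    moreover have "y 0 \<in> ?D" "x 0 \<bullet> y 0 = K_norm K (x 0)"
      using run(2) by (auto simp: convex_subdiff_K_norm[OF K])
    ultimately show ?case using K_norm_nonneg[OF K, of "x 0"] by simp
  next
    case (Suc t)
    show ?case
    proof (cases "t mod Suc N = 0")
      case True
      from y_step[OF this] Suc obtain \<alpha> where \<alpha>: "\<alpha>min \<le> \<alpha>" "x (Suc t) = x t" "y (Suc t) \<in> ?D"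
        "\<forall>y'\<in>?D. (y t + \<alpha> *\<^sub>R x t - y (Suc t)) \<bullet> (y' - y (Suc t)) \<le> 0" by auto
      have "(y t + \<alpha> *\<^sub>R x t - y (Suc t)) \<bullet> (y t - y (Suc t)) \<le> 0" using \<alpha>(4) Suc by blast
      then have "(norm (y t - y (Suc t)))\<^sup>2 \<le> \<alpha> * (x t \<bullet> y (Suc t) - x t \<bullet> y t)"
        by (simp add: power2_norm_eq_inner algebra_simps inner_commute)
      then have "0 \<le> \<alpha> * (x t \<bullet> y (Suc t) - x t \<bullet> y t)" by (rule order_trans[OF zero_le_power2])
      then have "x t \<bullet> y t \<le> x t \<bullet> y (Suc t)" using \<alpha>(1) \<alpha>min by (simp add: zero_le_mult_iff)
      with \<alpha>(2,3) Suc show ?thesis by simp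
    next
      case False
      from x_step[OF this] Suc obtain \<beta> where \<beta>: "\<alpha>min \<le> \<beta>" "y (Suc t) = y t"
        "x (Suc t) \<in> trial_points blk N (box_l1 blk xlo xhi) (least_squares lam A b) (K_norm K) (t mod Suc N) \<beta> (x t) (y t)"
        "?zeta (x (Suc t)) + \<sigma> / 2 * (norm (x (Suc t) - x t))\<^sup>2 \<le> Q t * (x (Suc t) \<bullet> y t)" by auto
      have "0 < \<beta>" using \<beta>(1) \<alpha>min by simp
      with Suc \<beta>(3) have "x (Suc t) \<in> cbox xlo xhi" using trial_points_properties(1)[OF part K] by blast
      moreover have "0 < ?zeta (x (Suc t)) + \<sigma> / 2 * (norm (x (Suc t) - x t))\<^sup>2"
        using l1_least_squares_pos[OF assms(1,2), of A "x (Suc t)"] assms(8) by (simp add: add_pos_nonneg)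
      then have "0 < Q t * (x (Suc t) \<bullet> y t)" using \<beta>(4) by linarith
      moreover have "0 < Q t"
        using l1_least_squares_pos[OF assms(1,2), of A "x t"] Suc by (simp add: Q_def)
      ultimately show ?thesis using \<beta>(2) Suc by (simp add: zero_less_mult_iff)
    qed
  qed
  interpret cyclic_descent A b lam \<alpha>min \<alpha>hi \<sigma> xlo xhi ?D blk N x y Q
  proof
    show "polytope ?D" by (intro polytope_convex_hull finite_sparse_sign_vectors)
    show "blk j \<in> {1..N}" for j using part by (auto simp: block_partition_def)
    fix t
    show "x (Suc t) = x t \<and> (\<exists>\<alpha>\<in>{\<alpha>min..\<alpha>hi}. \<forall>y'\<in>?D.
      (y t + \<alpha> *\<^sub>R x t - y (Suc t)) \<bullet> (y' - y (Suc t)) \<le> 0)" if "t mod Suc N = 0"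
      using y_step[OF that] inv by blast
    assume t: "t mod Suc N \<noteq> 0"
    then obtain \<beta> where \<beta>: "\<alpha>min \<le> \<beta>" "y (Suc t) = y t"
        "x (Suc t) \<in> trial_points blk N (box_l1 blk xlo xhi) (least_squares lam A b) (K_norm K) (t mod Suc N) \<beta> (x t) (y t)"
        "?zeta (x (Suc t)) + \<sigma> / 2 * (norm (x (Suc t) - x t))\<^sup>2 \<le> Q t * (x (Suc t) \<bullet> y t)"
      using x_step[OF t] inv by blast
    have "0 < \<beta>" using \<beta>(1) \<alpha>min by simp
    note tp = trial_points_properties[OF part K this inv[THEN conjunct1]
        inv[THEN conjunct2, THEN conjunct1] inv[THEN conjunct2, THEN conjunct2] \<beta>(3)]
    show "y (Suc t) = y t" by fact
    show "?zeta (x (Suc t)) + \<sigma> / 2 * (norm (x (Suc t) - x t))\<^sup>2 \<le> Q t * (x (Suc t) \<bullet> y t)" by fact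
    show "x (Suc t) $ j = x t $ j" if "blk j \<noteq> t mod Suc N" for j using tp(2)[OF that] .
    show "\<exists>\<alpha>\<ge>\<alpha>min. \<forall>j. blk j = t mod Suc N \<longrightarrow> (\<forall>s\<in>{xlo $ j..xhi $ j}. \<bar>x (Suc t) $ j\<bar> +
        ((x t - x (Suc t)) $ j / \<alpha> - least_squares_grad lam A b (x t) $ j + Q t * y t $ j)
          * (s - x (Suc t) $ j) \<le> \<bar>s\<bar>)"
      using \<beta>(1) tp(3) unfolding Q_def by blast
  qed (use assms(1,2,8) \<alpha>min inv Q_def in auto)
  obtain xs ys C \<theta> Qs where lim: "0 < \<theta>" "\<theta> < 1" "\<And>t. norm (x t - xs) \<le> C * \<theta> ^ t"
    "xs \<in> cbox xlo xhi" "ys \<in> ?D" "0 < xs \<bullet> ys" "?zeta xs = Qs * (xs \<bullet> ys)"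
    "\<And>y'. y' \<in> ?D \<Longrightarrow> xs \<bullet> y' \<le> xs \<bullet> ys"
    "\<And>z. z \<in> cbox xlo xhi \<Longrightarrow>
      l1_norm xs + (Qs *\<^sub>R ys - least_squares_grad lam A b xs) \<bullet> (z - xs) \<le> l1_norm z"
    using linear_convergence by metis
  \<comment> \<open>The K-norm is the maximum of the product over the ball, and \<open>ys\<close>
    attains that maximum; so \<open>ys\<close> is a subgradient of the K-norm at \<open>xs\<close>
    and the quotient F there equals \<open>Qs\<close>.\<close>
  have g: "K_norm K xs = xs \<bullet> ys"
    using K_norm_attained[OF K, of xs] inner_le_K_norm[OF K lim(5), of xs] lim(8) by (metis order_antisym)
  have F: "frac_F (block_sum blk N (box_l1 blk xlo xhi)) (least_squares lam A b) (K_norm K) xs = ereal Qs"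
    using lim(6,7) by (simp add: frac_F_eq[OF part lim(4)] g)
  have u: "Qs *\<^sub>R ys - least_squares_grad lam A b xs \<in> frechet_subdiff (block_sum blk N (box_l1 blk xlo xhi)) xs"
    using subgradient_in_frechet_subdiff[OF block_sum_box_l1[OF part] lim(4,9)] .
  have v: "ys \<in> convex_subdiff (K_norm K) xs"
    using lim(5) g by (simp add: convex_subdiff_K_norm[OF K])
  have "0 = (Qs *\<^sub>R ys - least_squares_grad lam A b xs) + least_squares_grad lam A b xs
      - real_of_ereal (ereal Qs) *\<^sub>R ys" by simp
  with u v have "critical_point (block_sum blk N (box_l1 blk xlo xhi)) (least_squares lam A b) (K_norm K) xs"
    unfolding critical_point_def gradient_least_squares F eff_dom_def[of "frac_F _ _ _"] mem_Collect_eq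
    by (intro conjI) (simp, blast)
  moreover have "R_linearly_converges x xs"
    unfolding R_linearly_converges_def
  proof (intro exI conjI bexI allI impI)
    \<comment> \<open>The definition asks for a strictly positive constant, which \<bar>C\<bar> + 1
      provides.\<close>
    show "norm (x t - xs) \<le> (\<bar>C\<bar> + 1) * \<theta> ^ t" for t
    proof -
      have "C * \<theta> ^ t \<le> (\<bar>C\<bar> + 1) * \<theta> ^ t" using lim(1) by (intro mult_right_mono) auto
      with lim(3)[of t] show ?thesis by linarith
    qed
  qed (use lim in auto)
  ultimately show ?thesis by blast
qed

end
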